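(* Let $\lambda>0$. Assume that the proposal distribution $r(\boldsymbol{X}^{(\text{joint})})$ is factorized as $r(\boldsymbol{X}^{(\text{joint})}):=r(\boldsymbol{X}^{(\text{miss})})\,p(\boldsymbol{X}^{(\text{obs})})$. Define the cost functional associated with the joint distribution by $$\mathcal{F}_{\text{joint-NER}}:=\mathbb{E}_{r(\boldsymbol{X}^{(\text{joint})})}\big[\log\hat p(\boldsymbol{X}^{(\text{joint})})\big]-\lambda\,\mathbb{H}[r(\boldsymbol{X}^{(\text{joint})})].$$ Then $\mathcal{F}_{\text{joint-NER}}$ leads to the velocity field $$u(\boldsymbol{X}^{(\text{joint})},\tau)=\mathbb{E}_{r(\tilde{\boldsymbol{X}}^{(\text{joint})},\tau)}\Big\{-\lambda\nabla_{\tilde{\boldsymbol{X}}^{(\text{miss})}}\mathcal{K}(\boldsymbol{X}^{(\text{joint})},\tilde{\boldsymbol{X}}^{(\text{joint})})+[\nabla_{\tilde{\boldsymbol{X}}^{(\text{miss})}}\log\hat p(\tilde{\boldsymbol{X}}^{(\text{joint})})]^\top\mathcal{K}(\boldsymbol{X}^{(\text{joint})},\tilde{\boldsymbol{X}}^{(\text{joint})})\Big\},$$ and $\mathcal{F}_{\text{joint-NER}}$ is a lower bound for $$\mathcal{F}_{\text{NER}}:=\mathbb{E}_{r(\boldsymbol{X}^{(\text{miss})})}\big[\log\hat p(\boldsymbol{X}^{(\text{miss})}\mid\boldsymbol{X}^{(\text{obs})})\big]-\lambda\,\mathbb{H}[r(\boldsymbol{X}^{(\text{miss})})],$$ with the difference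 being a constant, i.e. $\mathcal{F}_{\text{joint-NER}}=\mathcal{F}_{\text{NER}}-\text{const}$ with $\text{const}\ge 0$.
   Context: $\boldsymbol{X}^{(\text{obs})}$ denotes the observed entries of the data, with distribution $p(\boldsymbol{X}^{(\text{obs})})$, which remain unchanged during imputation; $\boldsymbol{X}^{(\text{miss})}$ denotes the missing entries, with density $r(\boldsymbol{X}^{(\text{miss})})$ (the proposal distribution) evolving in time $\tau$; $\boldsymbol{X}^{(\text{joint})}=(\boldsymbol{X}^{(\text{miss})},\boldsymbol{X}^{(\text{obs})})$. $\hat p(\boldsymbol{X}^{(\text{joint})})$ is a given (estimated) joint density with conditional $\hat p(\boldsymbol{X}^{(\text{miss})}\mid\boldsymbol{X}^{(\text{obs})})$. The entropy of a density $q$ is $\mathbb{H}[q]:=-\int q\log q$; the paper takes entropies to be non-negative. "Constant" means not depending on $r(\boldsymbol{X}^{(\text{miss})})$. The kernel is the radial basis function kernel $\mathcal{K}(\boldsymbol{X},\tilde{\boldsymbol{X}}):=\exp\big(-\frac{\|\boldsymbol{X}-\tilde{\boldsymbol{X}}\|^2}{2h^2}\big)$ with bandwidth $h$, and $\mathcal{H}$ is its reproducing kernel Hilbert space; $\mathcal{H}^d$ is the space of vector fields with components in $\mathcal{H}$, with squared norm the sum of squared component norms. A functional $\mathcal{F}$ "leads to" the velocity field $u$ if $u$ is the RKHS-regularized steepest ascent direction: $u=\arg\max_{v\in\mathcal{H}^d}\{\frac{\mathrm{d}\mathcal{F}}{\mathrm{d}\tau}-\frac12\|v\|_{\mathcal{H}}^2\}$,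 where $\frac{\mathrm{d}\mathcal{F}}{\mathrm{d}\tau}$ is computed along the continuity equation in which only the missing coordinates move, $\partial_\tau r(\boldsymbol{X}^{(\text{joint})},\tau)=-\nabla_{\boldsymbol{X}^{(\text{miss})}}\cdot[r(\boldsymbol{X}^{(\text{joint})},\tau)v(\boldsymbol{X}^{(\text{joint})},\tau)]$; for $\mathcal{F}_{\text{joint-NER}}$ this rate is $\mathbb{E}_{r(\boldsymbol{X}^{(\text{joint})},\tau)}[v^\top\nabla_{\boldsymbol{X}^{(\text{miss})}}\log\hat p(\boldsymbol{X}^{(\text{joint})})-\lambda\nabla_{\boldsymbol{X}^{(\text{miss})}}\cdot v]$. *)

theory Defs
  imports "HOL-Analysis.Analysis"
begin

text \<open>The missing entries live in \<^typ>\<open>'m::euclidean_space\<close>, the observed entries in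
  \<^typ>\<open>'o::euclidean_space\<close>, and a joint sample is a pair (missing, observed).\<close>

section \<open>Densities, expectation, entropy\<close>

definition prob_density :: "('a::euclidean_space \<Rightarrow> real) \<Rightarrow> bool" where
  "prob_density q \<longleftrightarrow>
     (\<forall>x. 0 \<le> q x) \<and> integrable lborel q \<and> integral\<^sup>L lborel q = 1"

abbreviation law :: "('a::euclidean_space \<Rightarrow> real) \<Rightarrow> 'a measure" where
  "law q \<equiv> density lborel (\<lambda>x. ennreal (q x))"

definition expect ::
    "('a::euclidean_space \<Rightarrow> real) \<Rightarrow> ('a \<Rightarrow> 'b::{banach, second_countable_topology}) \<Rightarrow> 'b" where
  "expect q f = integral\<^sup>L (law q) f"

text \<open>\<^term>\<open>ln 0 = (0::real)\<close> gives the usual convention that the integrand vanishes where the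
  density does.\<close>

definition diff_entropy :: "('a::euclidean_space \<Rightarrow> real) \<Rightarrow> real" where
  "diff_entropy q = - (LINT x|lborel. q x * ln (q x))"

definition finite_entropy :: "('a::euclidean_space \<Rightarrow> real) \<Rightarrow> bool" where
  "finite_entropy q \<longleftrightarrow> integrable lborel (\<lambda>x. q x * ln (q x))"

definition joint :: "('m \<Rightarrow> real) \<Rightarrow> ('o \<Rightarrow> real) \<Rightarrow> 'm \<times> 'o \<Rightarrow> real" where
  "joint r p x = r (fst x) * p (snd x)"

definition marginal_obs ::
    "('m::euclidean_space \<times> 'o::euclidean_space \<Rightarrow> real) \<Rightarrow> 'o \<Rightarrow> real" where
  "marginal_obs phat y = (LINT m|lborel. phat (m, y))"

definition conditional_miss ::
    "('m::euclidean_space \<times> 'o::euclidean_space \<Rightarrow> real) \<Rightarrow> 'm \<Rightarrow> 'o \<Rightarrow> real" where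
  "conditional_miss phat m y = phat (m, y) / marginal_obs phat y"

section \<open>Differential operators in the missing coordinates\<close>

definition differentiable_miss ::
    "('m::euclidean_space \<times> 'o \<Rightarrow> 'b::real_normed_vector) \<Rightarrow> bool" where
  "differentiable_miss f \<longleftrightarrow> (\<forall>m y. (\<lambda>z. f (z, y)) differentiable (at m))"

definition grad_miss :: "('m::euclidean_space \<times> 'o \<Rightarrow> real) \<Rightarrow> 'm \<times> 'o \<Rightarrow> 'm" where
  "grad_miss f x =
     (\<Sum>b\<in>Basis. frechet_derivative (\<lambda>z. f (z, snd x)) (at (fst x)) b *\<^sub>R b)"

definition div_miss :: "('m::euclidean_space \<times> 'o \<Rightarrow> 'm) \<Rightarrow> 'm \<times> 'o \<Rightarrow> real" where
  "div_miss v x =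
     (\<Sum>b\<in>Basis. frechet_derivative (\<lambda>z. v (z, snd x)) (at (fst x)) b \<bullet> b)"

section \<open>The two cost functionals\<close>

definition F_joint_NER ::
    "('m::euclidean_space \<times> 'o::euclidean_space \<Rightarrow> real) \<Rightarrow> real \<Rightarrow> ('m \<times> 'o \<Rightarrow> real) \<Rightarrow> real" where
  "F_joint_NER phat lam q = expect q (\<lambda>x. ln (phat x)) - lam * diff_entropy q"

text \<open>The conditional log-likelihood depends on the observed entries, which are random with
  density \<open>p\<close>; the expectation is therefore taken over \<open>p\<close> as well (the observed entries being
  independent of the proposal for the missing ones).\<close>

definition F_NER ::
    "('m::euclidean_space \<times> 'o::euclidean_space \<Rightarrow> real) \<Rightarrow> ('o \<Rightarrow> real) \<Rightarrow> real \<Rightarrow> ('m \<Rightarrow> real) \<Rightarrow> real" where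
  "F_NER phat p lam r =
     expect p (\<lambda>y. expect r (\<lambda>m. ln (conditional_miss phat m y))) - lam * diff_entropy r"

section \<open>Kernel and reproducing kernel Hilbert space\<close>

definition rbf :: "real \<Rightarrow> 'a::real_normed_vector \<Rightarrow> 'a \<Rightarrow> real" where
  "rbf h x y = exp (- ((norm (x - y))\<^sup>2 / (2 * h\<^sup>2)))"

text \<open>\<open>H\<close> with inner product \<open>ip\<close> is the reproducing kernel Hilbert space of \<open>k\<close>: a real Hilbert
  space of functions containing every kernel section and having the reproducing property.
  By the Moore--Aronszajn theorem it is determined by \<open>k\<close>.\<close>

locale rkhs =
  fixes k :: "'a \<Rightarrow> 'a \<Rightarrow> real"
    and H :: "('a \<Rightarrow> real) set"
    and ip :: "('a \<Rightarrow> real) \<Rightarrow> ('a \<Rightarrow> real) \<Rightarrow> real"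
  assumes zero_mem: "(\<lambda>x. 0) \<in> H"
    and add_mem: "\<And>f g. f \<in> H \<Longrightarrow> g \<in> H \<Longrightarrow> (\<lambda>x. f x + g x) \<in> H"
    and scale_mem: "\<And>c f. f \<in> H \<Longrightarrow> (\<lambda>x. c * f x) \<in> H"
    and ip_commute: "\<And>f g. f \<in> H \<Longrightarrow> g \<in> H \<Longrightarrow> ip f g = ip g f"
    and ip_add: "\<And>f g e. f \<in> H \<Longrightarrow> g \<in> H \<Longrightarrow> e \<in> H \<Longrightarrow>
                   ip (\<lambda>x. f x + g x) e = ip f e + ip g e"
    and ip_scale: "\<And>c f g. f \<in> H \<Longrightarrow> g \<in> H \<Longrightarrow> ip (\<lambda>x. c * f x) g = c * ip f g"
    and ip_nonneg: "\<And>f. f \<in> H \<Longrightarrow> 0 \<le> ip f f"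
    and ip_definite: "\<And>f. f \<in> H \<Longrightarrow> ip f f = 0 \<Longrightarrow> f = (\<lambda>x. 0)"
    and complete: "\<And>f :: nat \<Rightarrow> 'a \<Rightarrow> real.
           (\<And>n. f n \<in> H) \<Longrightarrow>
           (\<And>e. e > 0 \<Longrightarrow> \<exists>N. \<forall>i\<ge>N. \<forall>j\<ge>N.
               sqrt (ip (\<lambda>x. f i x - f j x) (\<lambda>x. f i x - f j x)) < e) \<Longrightarrow>
           \<exists>g\<in>H. (\<lambda>n. sqrt (ip (\<lambda>x. f n x - g x) (\<lambda>x. f n x - g x))) \<longlonglongrightarrow> 0"
    and section_mem: "\<And>x. k x \<in> H"
    and reproducing: "\<And>f x. f \<in> H \<Longrightarrow> f x = ip f (k x)"

definition vfields :: "('a \<Rightarrow> real) set \<Rightarrow> ('a \<Rightarrow> 'm::euclidean_space) set" where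
  "vfields H = {v. \<forall>b\<in>Basis. (\<lambda>x. v x \<bullet> b) \<in> H}"

definition vnorm_sq ::
    "(('a \<Rightarrow> real) \<Rightarrow> ('a \<Rightarrow> real) \<Rightarrow> real) \<Rightarrow> ('a \<Rightarrow> 'm::euclidean_space) \<Rightarrow> real" where
  "vnorm_sq ip v = (\<Sum>b\<in>Basis. ip (\<lambda>x. v x \<bullet> b) (\<lambda>x. v x \<bullet> b))"

section \<open>Rate of change along the continuity equation; steepest ascent\<close>

definition continuity_equation ::
    "real set \<Rightarrow> (real \<Rightarrow> 'm::euclidean_space \<times> 'o \<Rightarrow> 'm) \<Rightarrow> (real \<Rightarrow> 'm \<times> 'o \<Rightarrow> real) \<Rightarrow> bool" where
  "continuity_equation T w \<rho> \<longleftrightarrow>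
     (\<forall>t\<in>T. differentiable_miss (\<lambda>x. \<rho> t x *\<^sub>R w t x) \<and>
        (\<forall>x. ((\<lambda>s. \<rho> s x) has_real_derivative - div_miss (\<lambda>y. \<rho> t y *\<^sub>R w t y) x) (at t)))"

text \<open>A solution of the continuity equation around time \<open>\<tau>\<close> whose velocity field at time \<open>\<tau>\<close> is
  \<open>v\<close>, regular enough to differentiate the cost functional under the integral sign
  (domination by \<open>G\<close>) and to integrate by parts in the missing coordinates without boundary
  terms (integrability conditions at time \<open>\<tau>\<close>).\<close>

definition regular_evolution ::
    "('m::euclidean_space \<times> 'o::euclidean_space \<Rightarrow> real) \<Rightarrow> real \<Rightarrow> ('m \<times> 'o \<Rightarrow> 'm) \<Rightarrow>
     (real \<Rightarrow> 'm \<times> 'o \<Rightarrow> real) \<Rightarrow> bool" where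
  "regular_evolution phat \<tau> v \<rho> \<longleftrightarrow>
     (\<exists>\<epsilon>>0. \<exists>w G.
        w \<tau> = v \<and>
        continuity_equation {\<tau> - \<epsilon><..<\<tau> + \<epsilon>} w \<rho> \<and>
        (\<forall>t\<in>{\<tau> - \<epsilon><..<\<tau> + \<epsilon>}. prob_density (\<rho> t) \<and> (\<forall>x. 0 < \<rho> t x)) \<and>
        integrable lborel G \<and>
        (\<forall>t\<in>{\<tau> - \<epsilon><..<\<tau> + \<epsilon>}. \<forall>x.
           \<bar>div_miss (\<lambda>y. \<rho> t y *\<^sub>R w t y) x\<bar> * (1 + \<bar>ln (\<rho> t x)\<bar> + \<bar>ln (phat x)\<bar>) \<le> G x)) \<and>
     differentiable_miss (\<rho> \<tau>) \<and>
     finite_entropy (\<rho> \<tau>) \<and>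
     integrable lborel (\<lambda>x. \<rho> \<tau> x * ln (phat x)) \<and>
     integrable lborel (\<lambda>x. \<rho> \<tau> x *\<^sub>R grad_miss (\<lambda>y. ln (phat y)) x) \<and>
     integrable lborel (\<lambda>x. (1 + \<bar>ln (\<rho> \<tau> x)\<bar> + \<bar>ln (phat x)\<bar>) *\<^sub>R grad_miss (\<rho> \<tau>) x)"

definition has_rate ::
    "('m::euclidean_space \<times> 'o::euclidean_space \<Rightarrow> real) \<Rightarrow> (('m \<times> 'o \<Rightarrow> real) \<Rightarrow> real) \<Rightarrow>
     ('m \<times> 'o \<Rightarrow> real) \<Rightarrow> real \<Rightarrow> ('m \<times> 'o \<Rightarrow> 'm) \<Rightarrow> real \<Rightarrow> bool" where
  "has_rate phat F q \<tau> v D \<longleftrightarrow>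
     (\<forall>\<rho>. regular_evolution phat \<tau> v \<rho> \<and> \<rho> \<tau> = q \<longrightarrow>
        ((\<lambda>t. F (\<rho> t)) has_real_derivative D) (at \<tau>))"

definition joint_NER_rate ::
    "('m::euclidean_space \<times> 'o::euclidean_space \<Rightarrow> real) \<Rightarrow> real \<Rightarrow> ('m \<times> 'o \<Rightarrow> real) \<Rightarrow>
     ('m \<times> 'o \<Rightarrow> 'm) \<Rightarrow> real" where
  "joint_NER_rate phat lam q v =
     expect q (\<lambda>x. v x \<bullet> grad_miss (\<lambda>y. ln (phat y)) x - lam * div_miss v x)"

text \<open>\<open>F\<close> leads to \<open>u\<close> at the density \<open>q\<close>: \<open>R v\<close> is the rate of change of \<open>F\<close> in direction \<open>v\<close>, and
  \<open>u\<close> is the unique maximiser of the regularised rate. The rate functional \<open>R\<close> is a parameter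
  rather than existentially quantified: for a rough density no regular evolution
  need exist, and then \<^const>\<open>has_rate\<close> alone would not determine \<open>R\<close>.\<close>

definition leads_to ::
    "('m::euclidean_space \<times> 'o::euclidean_space \<Rightarrow> real) set \<Rightarrow>
     (('m \<times> 'o \<Rightarrow> real) \<Rightarrow> ('m \<times> 'o \<Rightarrow> real) \<Rightarrow> real) \<Rightarrow>
     ('m \<times> 'o \<Rightarrow> real) \<Rightarrow> (('m \<times> 'o \<Rightarrow> real) \<Rightarrow> real) \<Rightarrow> (('m \<times> 'o \<Rightarrow> 'm) \<Rightarrow> real) \<Rightarrow>
     ('m \<times> 'o \<Rightarrow> real) \<Rightarrow> real \<Rightarrow> ('m \<times> 'o \<Rightarrow> 'm) \<Rightarrow> bool" where
  "leads_to H ip phat F R q \<tau> u \<longleftrightarrow>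
     (\<forall>v\<in>vfields H. has_rate phat F q \<tau> v (R v)) \<and>
     is_arg_max (\<lambda>v. R v - 1/2 * vnorm_sq ip v) (\<lambda>v. v \<in> vfields H) u \<and>
     (\<forall>v. is_arg_max (\<lambda>v. R v - 1/2 * vnorm_sq ip v) (\<lambda>v. v \<in> vfields H) v \<longrightarrow> v = u)"

definition joint_NER_velocity ::
    "('m::euclidean_space \<times> 'o::euclidean_space \<Rightarrow> real) \<Rightarrow> real \<Rightarrow> real \<Rightarrow> ('m \<times> 'o \<Rightarrow> real) \<Rightarrow>
     'm \<times> 'o \<Rightarrow> 'm" where
  "joint_NER_velocity phat lam h q X =
     expect q (\<lambda>Y. - lam *\<^sub>R grad_miss (\<lambda>Z. rbf h X Z) Y
                    + rbf h X Y *\<^sub>R grad_miss (\<lambda>Z. ln (phat Z)) Y)"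

end

theory Submission
  imports Defs
begin

text \<open>For the velocity field, the rate functional decouples into one bounded linear functional
  \<open>f \<mapsto> \<integral> (f \<partial>\<^sub>b log phat - lam \<partial>\<^sub>b f) dq\<close> per missing coordinate: in a Gaussian reproducing kernel
  Hilbert space every function is differentiable with \<open>\<bar>f\<bar> \<le> \<parallel>f\<parallel>\<close> and \<open>\<bar>\<partial>\<^sub>a f\<bar> \<le> \<parallel>f\<parallel> \<bar>a\<bar> / h\<close>.
  Evaluating the functional at the kernel sections identifies its Riesz representer with the
  corresponding component of the claimed velocity, and completing the square makes that field the
  unique maximiser. That the rate functional is the derivative of the cost along the continuity
  equation follows by differentiating under the integral and integrating by parts.

  For the comparison, \<open>log phat(m, o) = log phat(m | o) + log phat(o)\<close> and the additivity of the
  entropy show that the difference is the cross entropy of \<open>p\<close> and the observed marginal of \<open>phat\<close>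
  plus \<open>lam\<close> times the entropy of \<open>p\<close>; the former dominates the entropy of \<open>p\<close>.\<close>

section \<open>Hilbert space facts\<close>

text \<open>The reproducing kernel Hilbert space is given only by its axioms, so nothing about its
  members can be read off a concrete model: differentiability has to come out of the reproducing
  property. This is why the derivative of a kernel section with respect to its centre is constructed
  inside the space. Difference quotients of sections are Cauchy because their Gram matrix, an
  explicit Gaussian expression, converges as both indices grow. Pairing with the limit then yields
  the derivative of every \<open>f\<close> together with its bound.

  Two further obstacles concern integrability. The score is merely integrable, which suffices
  because members of the space and their first derivatives are bounded. In the gap, integrability of
  \<open>p y * ln (marginal_obs phat y)\<close> is not a hypothesis; it is squeezed between two uses
  of Gibbs' inequality, one for \<open>p\<close> against the observed marginal and one for
  \<open>r\<close> against the conditional density. The constant still has to be fixed before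
  \<open>r\<close>, and to be nonnegative even when no \<open>r\<close> is admissible and that
  integral may diverge.\<close>

context rkhs
begin

lemma diff_mem:
  assumes "f \<in> H" "g \<in> H"
  shows "(\<lambda>x. f x - g x) \<in> H"
  using add_mem[OF assms(1) scale_mem[OF assms(2), of "-1"]] by simp

lemma ip_add_right:
  "f \<in> H \<Longrightarrow> g \<in> H \<Longrightarrow> e \<in> H \<Longrightarrow> ip e (\<lambda>x. f x + g x) = ip e f + ip e g"
  by (simp add: ip_commute[of e] ip_add add_mem)

lemma ip_scale_right: "f \<in> H \<Longrightarrow> g \<in> H \<Longrightarrow> ip g (\<lambda>x. c * f x) = c * ip g f"
  by (simp add: ip_commute[of g] ip_scale scale_mem)

lemma ip_diff:
  assumes "f \<in> H" "g \<in> H" "e \<in> H"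
  shows "ip (\<lambda>x. f x - g x) e = ip f e - ip g e"
  using ip_add[OF assms(1) scale_mem[OF assms(2), of "-1"] assms(3)]
    ip_scale[OF assms(2,3), of "-1"] by simp

lemma ip_diff_right:
  "f \<in> H \<Longrightarrow> g \<in> H \<Longrightarrow> e \<in> H \<Longrightarrow> ip e (\<lambda>x. f x - g x) = ip e f - ip e g"
  by (simp add: ip_commute[of e] ip_diff diff_mem)

lemma ip_diff_self:
  "f \<in> H \<Longrightarrow> g \<in> H \<Longrightarrow>
     ip (\<lambda>x. f x - g x) (\<lambda>x. f x - g x) = ip f f - 2 * ip f g + ip g g"
  by (simp add: ip_diff ip_diff_right diff_mem ip_commute[of g f])

lemma ip_section: "f \<in> H \<Longrightarrow> ip (k x) f = f x"
  by (simp add: reproducing ip_commute section_mem)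

definition hnorm :: "('a \<Rightarrow> real) \<Rightarrow> real" where
  "hnorm f = sqrt (ip f f)"

lemma hnorm_nonneg: "f \<in> H \<Longrightarrow> 0 \<le> hnorm f"
  by (simp add: hnorm_def ip_nonneg)

lemma hnorm_sq: "f \<in> H \<Longrightarrow> (hnorm f)\<^sup>2 = ip f f"
  by (simp add: hnorm_def ip_nonneg)

lemma cauchy_schwarz:
  assumes f: "f \<in> H" and g: "g \<in> H"
  shows "\<bar>ip f g\<bar> \<le> hnorm f * hnorm g"
proof (cases "ip g g = 0")
  case True
  then have "g = (\<lambda>x. 0)"
    using ip_definite g by blast
  then have "ip f g = 0"
    using ip_scale_right[OF g f, of 0] by simp
  then show ?thesis
    by (simp add: hnorm_nonneg f g)
next
  case False
  then have pos: "ip g g > 0"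
    using ip_nonneg[OF g] by simp
  define t where "t = ip f g / ip g g"
  have tg: "(\<lambda>x. t * g x) \<in> H"
    by (rule scale_mem[OF g])
  have "0 \<le> ip (\<lambda>x. f x - t * g x) (\<lambda>x. f x - t * g x)"
    by (rule ip_nonneg[OF diff_mem[OF f tg]])
  also have "\<dots> = ip f f - 2 * (t * ip f g) + t * (t * ip g g)"
    by (simp add: ip_diff_self[OF f tg] ip_scale ip_scale_right f g tg)
  also have "\<dots> = ip f f - (ip f g)\<^sup>2 / ip g g"
    using pos by (simp add: t_def power2_eq_square)
  finally have "(ip f g)\<^sup>2 \<le> ip f f * ip g g"
    using pos by (simp add: field_simps)
  then have "sqrt ((ip f g)\<^sup>2) \<le> sqrt (ip f f * ip g g)"
    by (rule real_sqrt_le_mono)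
  then show ?thesis
    by (simp add: hnorm_def real_sqrt_mult)
qed

lemma abs_eval_le:
  assumes "f \<in> H"
  shows "\<bar>f x\<bar> \<le> hnorm f * sqrt (k x x)"
  using cauchy_schwarz[OF assms section_mem[of x]]
  by (simp add: reproducing[OF assms] hnorm_def reproducing[OF section_mem, symmetric])

lemma complete_hnorm:
  assumes "\<And>n. f n \<in> H"
    and "\<And>e. e > 0 \<Longrightarrow> \<exists>N. \<forall>i\<ge>N. \<forall>j\<ge>N. hnorm (\<lambda>x. f i x - f j x) < e"
  obtains g where "g \<in> H" "(\<lambda>n. hnorm (\<lambda>x. f n x - g x)) \<longlonglongrightarrow> 0"
  using complete[of f] assms unfolding hnorm_def by blast

text \<open>Evaluation at a point is bounded by Cauchy-Schwarz against the kernel section. This is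
  how a limit that completeness supplies abstractly acquires an explicit formula.\<close>

lemma hnorm_tendsto_eval:
  assumes f: "\<And>n. f n \<in> H" and g: "g \<in> H"
    and lim: "(\<lambda>n. hnorm (\<lambda>x. f n x - g x)) \<longlonglongrightarrow> 0"
  shows "(\<lambda>n. f n x) \<longlonglongrightarrow> g x"
proof -
  have "(\<lambda>n. f n x - g x) \<longlonglongrightarrow> 0"
  proof (rule Lim_null_comparison)
    show "\<forall>\<^sub>F n in sequentially.
        norm (f n x - g x) \<le> hnorm (\<lambda>x. f n x - g x) * sqrt (k x x)"
      using abs_eval_le[OF diff_mem[OF f g]] by (intro always_eventually allI) simp
    show "(\<lambda>n. hnorm (\<lambda>x. f n x - g x) * sqrt (k x x)) \<longlonglongrightarrow> 0"
      using tendsto_mult_left_zero[OF lim] by simp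
  qed
  then show ?thesis
    by (simp add: LIM_zero_iff)
qed

text \<open>The representer is obtained as the maximiser of \<open>L f - \<parallel>f\<parallel>\<^sup>2 / 2\<close>: maximising sequences are
  Cauchy by the parallelogram law.\<close>

theorem riesz_representation:
  assumes L_add: "\<And>f g. f \<in> H \<Longrightarrow> g \<in> H \<Longrightarrow> L (\<lambda>x. f x + g x) = L f + L g"
    and L_scale: "\<And>c f. f \<in> H \<Longrightarrow> L (\<lambda>x. c * f x) = c * L f"
    and L_bound: "\<And>f. f \<in> H \<Longrightarrow> \<bar>L f\<bar> \<le> C * hnorm f"
  obtains g where "g \<in> H" "\<And>f. f \<in> H \<Longrightarrow> L f = ip f g"
proof -
  define J where "J f = L f - ip f f / 2" for f
  have J_le: "J f \<le> C\<^sup>2 / 2" if "f \<in> H" for f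
  proof -
    have "0 \<le> (C - hnorm f)\<^sup>2"
      by simp
    then show ?thesis
      using L_bound[OF that] unfolding J_def hnorm_sq[OF that, symmetric]
      by (simp add: power2_diff)
  qed
  have L_diff: "L (\<lambda>x. f x - g x) = L f - L g" if "f \<in> H" "g \<in> H" for f g
    using L_add[OF that(1) scale_mem[OF that(2), of "-1"]] L_scale[OF that(2), of "-1"] by simp
  have bdd: "bdd_above (J ` H)"
    unfolding bdd_above_def using J_le by blast
  define S where "S = Sup (J ` H)"
  have J_S: "J f \<le> S" if "f \<in> H" for f
    unfolding S_def using that bdd by (intro cSup_upper) auto
  have "\<exists>f\<in>H. S - 1 / real (Suc n) < J f" for n
  proof -
    have "S - 1 / real (Suc n) < Sup (J ` H)"
      by (simp add: S_def)
    then show ?thesis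
      using less_cSup_iff[OF _ bdd] zero_mem by auto
  qed
  then obtain F where F: "\<And>n. F n \<in> H" and FS: "\<And>n. S - 1 / real (Suc n) < J (F n)"
    by metis
  \<comment> \<open>The midpoint \<open>m\<close> satisfies
    \<open>2 * J m - J f - J g = ip (f - g) (f - g) / 4\<close> (pointwise difference), and
    \<open>J m\<close> is at most \<open>S\<close>; this is the source of the factor 4.\<close>
  have par: "ip (\<lambda>x. f x - g x) (\<lambda>x. f x - g x) \<le> 4 * ((S - J f) + (S - J g))"
    if f: "f \<in> H" and g: "g \<in> H" for f g
  proof -
    define m where "m = (\<lambda>x. 1/2 * (f x + g x))"
    have fg: "(\<lambda>x. f x + g x) \<in> H"
      by (rule add_mem[OF f g])
    then have m: "m \<in> H"
      unfolding m_def by (rule scale_mem)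
    have Lm: "L m = 1/2 * (L f + L g)"
      unfolding m_def by (simp only: L_scale[OF fg] L_add[OF f g])
    have "ip m m = 1/2 * (1/2 * ip (\<lambda>x. f x + g x) (\<lambda>x. f x + g x))"
      unfolding m_def
      by (simp only: ip_scale[OF fg scale_mem[OF fg]] ip_scale_right[OF fg fg])
    also have "ip (\<lambda>x. f x + g x) (\<lambda>x. f x + g x) = ip f f + 2 * ip f g + ip g g"
      using f g fg by (simp add: ip_add ip_add_right ip_commute[of g f])
    finally have "J m = 1/2 * (L f + L g) - (ip f f + 2 * ip f g + ip g g) / 8"
      unfolding J_def Lm by simp
    with J_S[OF m] show ?thesis
      unfolding J_def ip_diff_self[OF f g] by (simp add: field_simps)
  qed
  have Cauchy: "\<exists>N. \<forall>i\<ge>N. \<forall>j\<ge>N. hnorm (\<lambda>x. F i x - F j x) < e" if "e > 0" for e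
  proof -
    \<comment> \<open>Two deficits below \<open>e\<^sup>2 / 8\<close>, multiplied by the 4 of
      \<open>par\<close>, stay below \<open>e\<^sup>2\<close>.\<close>
    obtain N where N: "inverse (real (Suc N)) < e\<^sup>2 / 8"
      using reals_Archimedean[of "e\<^sup>2 / 8"] \<open>e > 0\<close> by (auto simp del: of_nat_Suc)
    have "hnorm (\<lambda>x. F i x - F j x) < e" if ij: "i \<ge> N" "j \<ge> N" for i j
    proof -
      have small: "S - J (F l) < e\<^sup>2 / 8" if "l \<ge> N" for l
      proof -
        have "1 / real (Suc l) \<le> inverse (real (Suc N))"
          using that by (simp add: field_simps)
        then show ?thesis
          using FS[of l] N by linarith
      qed
      have "4 * ((S - J (F i)) + (S - J (F j))) < e\<^sup>2"
        using small[OF ij(1)] small[OF ij(2)] by argo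
      then have "ip (\<lambda>x. F i x - F j x) (\<lambda>x. F i x - F j x) < e\<^sup>2"
        by (rule le_less_trans[OF par[OF F F]])
      then show ?thesis
        unfolding hnorm_def using \<open>e > 0\<close>
        by (metis less_eq_real_def real_sqrt_less_mono real_sqrt_unique)
    qed
    then show ?thesis
      by blast
  qed
  obtain g where g: "g \<in> H" and lim: "(\<lambda>n. hnorm (\<lambda>x. F n x - g x)) \<longlonglongrightarrow> 0"
    using complete_hnorm[OF F Cauchy] by blast
  have "(\<lambda>n. J (F n)) \<longlonglongrightarrow> J g"
  proof -
    let ?d = "\<lambda>n. hnorm (\<lambda>x. F n x - g x)"
    have J_eq: "J (F n) - J g = L (\<lambda>x. F n x - g x) - ip (\<lambda>x. F n x - g x) g - (?d n)\<^sup>2 / 2" for n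
      unfolding hnorm_sq[OF diff_mem[OF F g]] J_def
      by (simp add: L_diff ip_diff_self ip_diff F g field_simps)
    have "\<bar>J (F n) - J g\<bar> \<le> C * ?d n + ?d n * hnorm g + (?d n)\<^sup>2 / 2" for n
      unfolding J_eq
      using L_bound[OF diff_mem[OF F g], of n] cauchy_schwarz[OF diff_mem[OF F g] g, of n]
        zero_le_power2[of "?d n"]
      by linarith
    moreover have "(\<lambda>n. C * ?d n + ?d n * hnorm g + (?d n)\<^sup>2 / 2) \<longlonglongrightarrow> C * 0 + 0 * hnorm g + 0\<^sup>2 / 2"
      by (intro tendsto_intros lim) simp
    ultimately have "(\<lambda>n. J (F n) - J g) \<longlonglongrightarrow> 0"
      by (intro Lim_null_comparison[of "\<lambda>n. J (F n) - J g"] always_eventually allI) auto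
    then show ?thesis
      by (simp add: LIM_zero_iff)
  qed
  moreover have "(\<lambda>n. S - 1 / real (Suc n)) \<longlonglongrightarrow> S - 0"
    by (intro tendsto_intros LIMSEQ_Suc[OF lim_1_over_n])
  ultimately have "S \<le> J g"
    using LIMSEQ_le[of "\<lambda>n. S - 1 / real (Suc n)" "S - 0" "\<lambda>n. J (F n)" "J g"] FS
    by (metis diff_zero less_imp_le)
  have "L f = ip f g" if f: "f \<in> H" for f
  proof -
    define d where "d = L f - ip f g"
    \<comment> \<open>First-order optimality: the maximiser \<open>g\<close> is compared with its
      perturbations \<open>g + t f\<close>.\<close>
    have key: "t * d \<le> t\<^sup>2 / 2 * ip f f" for t
    proof -
      have tf: "(\<lambda>x. t * f x) \<in> H"
        by (rule scale_mem[OF f])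
      have "J (\<lambda>x. g x + t * f x) \<le> J g"
        using J_S[OF add_mem[OF g tf]] \<open>S \<le> J g\<close> by linarith
      moreover have "ip (\<lambda>x. g x + t * f x) (\<lambda>x. g x + t * f x)
          = ip g g + 2 * (t * ip f g) + t * (t * ip f f)"
        by (simp add: ip_add ip_add_right ip_scale ip_scale_right f g tf add_mem
            ip_commute[of g f])
      ultimately show ?thesis
        unfolding J_def d_def
        by (simp add: L_add L_scale f g tf power2_eq_square field_simps)
    qed
    \<comment> \<open>The summand 1 keeps the denominator positive when \<open>ip f f = 0\<close>.
      Inserting this \<open>s\<close> into \<open>key\<close> leaves a nonpositive product of
      \<open>s\<^sup>2\<close> and a positive number, hence \<open>s = 0\<close>.\<close>
    define s where "s = d / (ip f f + 1)"
    have n: "ip f f \<ge> 0"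
      by (rule ip_nonneg[OF f])
    then have "d = s * (ip f f + 1)"
      by (simp add: s_def)
    then have "s\<^sup>2 * (ip f f + 1) \<le> s\<^sup>2 / 2 * ip f f"
      using key[of s] by (simp add: power2_eq_square algebra_simps)
    then have "s\<^sup>2 * (ip f f / 2 + 1) \<le> 0"
      by (simp add: algebra_simps)
    then have "s = 0"
      using n by (simp add: mult_le_0_iff)
    then show ?thesis
      using \<open>d = s * (ip f f + 1)\<close> by (simp add: d_def)
  qed
  with g show ?thesis
    by (rule that)
qed

end

section \<open>The Gaussian kernel\<close>

locale gaussian_rkhs = rkhs "rbf h" H ip
  for h :: real and H :: "('a::euclidean_space \<Rightarrow> real) set" and ip +
  assumes h_pos: "h > 0"
begin

lemma rbf_self [simp]: "rbf h x x = 1"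
  by (simp add: rbf_def)

lemma rbf_commute: "rbf h x y = rbf h y x"
  by (simp add: rbf_def norm_minus_commute)

lemma ip_sections: "ip (rbf h x) (rbf h y) = rbf h x y"
  using reproducing[OF section_mem, of x y] by simp

lemma abs_le_hnorm: "f \<in> H \<Longrightarrow> \<bar>f x\<bar> \<le> hnorm f"
  using abs_eval_le[of f x] by simp

text \<open>The derivative of \<open>rbf h x y\<close> with respect to its centre \<open>x\<close>
  in direction \<open>a\<close>, as a function of \<open>y\<close>. By the reproducing property,
  pairing \<open>f\<close> with it should give the derivative of \<open>f\<close> at
  \<open>x\<close>.\<close>

definition section_deriv :: "'a \<Rightarrow> 'a \<Rightarrow> 'a \<Rightarrow> real" where
  "section_deriv x a y = rbf h x y * ((a \<bullet> (y - x)) / h\<^sup>2)"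

lemma rbf_has_derivative_along:
  "((\<lambda>t. rbf h (x + t *\<^sub>R a) y) has_real_derivative section_deriv x a y) (at 0)"
proof -
  have eq: "rbf h (x + t *\<^sub>R a) y
      = exp (- (((norm (x - y))\<^sup>2 + 2 * t * (a \<bullet> (x - y)) + t\<^sup>2 * (norm a)\<^sup>2) / (2 * h\<^sup>2)))" for t
    unfolding rbf_def power2_norm_eq_inner
    by (simp add: inner_commute inner_left_distrib inner_right_distrib inner_diff_left
        inner_diff_right power2_eq_square algebra_simps)
  show ?thesis
    unfolding eq unfolding section_deriv_def rbf_def using h_pos
    by (auto intro!: derivative_eq_intros simp: inner_diff_right field_simps)
qed

section \<open>Derivatives of kernel sections as limits of difference quotients\<close>

abbreviation diff_quot :: "'a \<Rightarrow> 'a \<Rightarrow> nat \<Rightarrow> 'a \<Rightarrow> real" where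
  "diff_quot x a n \<equiv> (\<lambda>y. real (Suc n) * (rbf h (x + inverse (real (Suc n)) *\<^sub>R a) y - rbf h x y))"

lemma diff_quot_mem: "diff_quot x a n \<in> H"
  by (intro scale_mem diff_mem section_mem)

lemma ip_diff_quot:
  assumes "f \<in> H"
  shows "ip f (diff_quot x a n)
    = real (Suc n) * (f (x + inverse (real (Suc n)) *\<^sub>R a) - f x)"
  by (simp only: ip_scale_right ip_diff_right diff_mem section_mem assms
      reproducing[OF assms, symmetric])

lemma LIMSEQ_inverse_Suc: "(\<lambda>n. inverse (real (Suc n))) \<longlonglongrightarrow> 0"
  using LIMSEQ_inverse_real_of_nat by simp

lemma deriv_imp_diff_quot_tendsto:
  fixes x a :: "'b::real_vector" and g :: "'b \<Rightarrow> real"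
  assumes "((\<lambda>t. g (x + t *\<^sub>R a)) has_real_derivative D) (at 0)"
  shows "(\<lambda>n. real (Suc n) * (g (x + inverse (real (Suc n)) *\<^sub>R a) - g x)) \<longlonglongrightarrow> D"
proof -
  have "((\<lambda>t. (g (x + t *\<^sub>R a) - g x) / t) \<longlongrightarrow> D) (at 0)"
    using assms by (simp add: has_field_derivative_iff)
  moreover have "filterlim (\<lambda>n. inverse (real (Suc n))) (at 0) sequentially"
    unfolding filterlim_at using LIMSEQ_inverse_Suc by simp
  ultimately have "(\<lambda>n. (g (x + inverse (real (Suc n)) *\<^sub>R a) - g x) / inverse (real (Suc n))) \<longlonglongrightarrow> D"
    by (rule filterlim_compose)
  then show ?thesis
    by (simp add: field_simps)
qed

text \<open>Along a line the exponent is quadratic in \<open>t - s\<close>; expanding the square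
  isolates the cross term \<open>t * s\<close>, the only factor that couples the two indices of the
  Gram matrix of difference quotients.\<close>

lemma rbf_shift:
  "rbf h (x + t *\<^sub>R a) (x + s *\<^sub>R a)
     = exp (- (t\<^sup>2 * ((norm a)\<^sup>2 / h\<^sup>2) / 2)) * exp (- (s\<^sup>2 * ((norm a)\<^sup>2 / h\<^sup>2) / 2))
       * exp (t * s * ((norm a)\<^sup>2 / h\<^sup>2))"
proof -
  have "norm ((x + t *\<^sub>R a) - (x + s *\<^sub>R a)) = \<bar>t - s\<bar> * norm a"
    by (metis add_diff_cancel_left norm_scaleR scaleR_left_diff_distrib)
  then have "(norm ((x + t *\<^sub>R a) - (x + s *\<^sub>R a)))\<^sup>2 = (t - s)\<^sup>2 * (norm a)\<^sup>2"
    by (simp add: power_mult_distrib)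
  then show ?thesis
    unfolding rbf_def exp_add[symmetric] using h_pos
    by (simp add: power2_eq_square field_simps)
qed

lemma rbf_shift0:
  "rbf h (x + t *\<^sub>R a) x = exp (- (t\<^sup>2 * ((norm a)\<^sup>2 / h\<^sup>2) / 2))"
  using rbf_shift[of x t a 0] by simp

text \<open>The limit is taken in both indices independently because the squared distance of two
  quotients combines two diagonal entries and one off-diagonal entry of the Gram matrix. Explicit
  lower and upper bounds make the joint limit a sandwich argument.\<close>

lemma ip_diff_quots_tendsto:
  "((\<lambda>(i, j). ip (diff_quot x a i) (diff_quot x a j)) \<longlongrightarrow> (norm a)\<^sup>2 / h\<^sup>2)
     (sequentially \<times>\<^sub>F sequentially)"
proof -
  define \<alpha> where "\<alpha> = (norm a)\<^sup>2 / h\<^sup>2"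
  have \<alpha>: "\<alpha> \<ge> 0"
    by (simp add: \<alpha>_def)
  define t where "t n = inverse (real (Suc n))" for n
  have t: "t n > 0" for n
    by (simp add: t_def)
  define \<phi> where "\<phi> u = exp (- (u\<^sup>2 * \<alpha> / 2))" for u :: real
  have \<phi>: "0 < \<phi> u" "\<phi> u \<le> 1" "1 - \<phi> u \<le> u\<^sup>2 * \<alpha> / 2" for u
  proof -
    show "0 < \<phi> u"
      by (simp add: \<phi>_def)
    show "\<phi> u \<le> 1"
      unfolding \<phi>_def using \<alpha> by simp
    show "1 - \<phi> u \<le> u\<^sup>2 * \<alpha> / 2"
      unfolding \<phi>_def using exp_ge_add_one_self[of "- (u\<^sup>2 * \<alpha> / 2)"] by linarith
  qed
  \<comment> \<open>The mixed second difference of the kernel, with the even factors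
    \<open>\<phi>\<close> split off. The first product vanishes in the limit, since
    \<open>1 - \<phi> u\<close> is of second order in \<open>u\<close>; the last quotient tends to
    \<open>\<alpha>\<close>.\<close>
  have G: "ip (diff_quot x a i) (diff_quot x a j)
      = ((1 - \<phi> (t i)) / t i) * ((1 - \<phi> (t j)) / t j)
        + \<phi> (t i) * \<phi> (t j) * ((exp (t i * t j * \<alpha>) - 1) / (t i * t j))" for i j
  proof -
    have "ip (diff_quot x a i) (diff_quot x a j)
        = real (Suc j) * (diff_quot x a i (x + inverse (real (Suc j)) *\<^sub>R a) - diff_quot x a i x)"
      by (rule ip_diff_quot[OF diff_quot_mem])
    also have "\<dots> = (1 / t j) * ((1 / t i) * (rbf h (x + t i *\<^sub>R a) (x + t j *\<^sub>R a)
        - rbf h (x + t j *\<^sub>R a) x) - (1 / t i) * (rbf h (x + t i *\<^sub>R a) x - 1))"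
      unfolding t_def by (simp add: rbf_commute[of x] inverse_eq_divide)
    also have "\<dots> = (1 / t j) * ((1 / t i) * (\<phi> (t i) * \<phi> (t j) * exp (t i * t j * \<alpha>) - \<phi> (t j))
        - (1 / t i) * (\<phi> (t i) - 1))"
      unfolding rbf_shift rbf_shift0 \<phi>_def \<alpha>_def ..
    also have "\<dots> = ((1 - \<phi> (t i)) / t i) * ((1 - \<phi> (t j)) / t j)
        + \<phi> (t i) * \<phi> (t j) * ((exp (t i * t j * \<alpha>) - 1) / (t i * t j))"
      using t[of i] t[of j] by (simp add: field_simps)
    finally show ?thesis .
  qed
  have lower: "\<phi> (t i) * \<phi> (t j) * \<alpha> \<le> ip (diff_quot x a i) (diff_quot x a j)" for i j
  proof -
    have "t i * t j * \<alpha> \<le> exp (t i * t j * \<alpha>) - 1"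
      using exp_ge_add_one_self[of "t i * t j * \<alpha>"] by linarith
    then have "\<alpha> \<le> (exp (t i * t j * \<alpha>) - 1) / (t i * t j)"
      using t[of i] t[of j] by (simp add: field_simps)
    then have "\<phi> (t i) * \<phi> (t j) * \<alpha> \<le> \<phi> (t i) * \<phi> (t j) * ((exp (t i * t j * \<alpha>) - 1) / (t i * t j))"
      using \<phi>(1)[of "t i"] \<phi>(1)[of "t j"] by (intro mult_left_mono) auto
    moreover have "0 \<le> ((1 - \<phi> (t i)) / t i) * ((1 - \<phi> (t j)) / t j)"
      using \<phi>(2) t[of i] t[of j] by (intro mult_nonneg_nonneg divide_nonneg_pos) auto
    ultimately show ?thesis
      unfolding G by linarith
  qed
  have upper: "ip (diff_quot x a i) (diff_quot x a j)
      \<le> (t i * \<alpha> / 2) * (t j * \<alpha> / 2) + \<alpha> * exp (t i * t j * \<alpha>)" for i j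
  proof -
    define u where "u = t i * t j * \<alpha>"
    have "(1 - u) * exp u \<le> exp (- u) * exp u"
      using exp_ge_add_one_self[of "- u"] by (intro mult_right_mono) auto
    then have "exp u - 1 \<le> u * exp u"
      by (simp add: exp_minus algebra_simps)
    then have 1: "(exp u - 1) / (t i * t j) \<le> \<alpha> * exp u"
      using t[of i] t[of j] by (simp add: u_def field_simps)
    have "0 \<le> exp u - 1"
      using exp_ge_add_one_self[of u] \<alpha> t[of i] t[of j] by (simp add: u_def)
    then have 2: "0 \<le> (exp u - 1) / (t i * t j)"
      using t[of i] t[of j] by (intro divide_nonneg_pos) auto
    have "\<phi> (t i) * \<phi> (t j) \<le> 1"
      using \<phi> mult_mono[of "\<phi> (t i)" 1 "\<phi> (t j)" 1] by (simp add: less_imp_le)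
    then have "\<phi> (t i) * \<phi> (t j) * ((exp u - 1) / (t i * t j)) \<le> \<alpha> * exp u"
      using mult_right_mono[OF _ 2, of "\<phi> (t i) * \<phi> (t j)" 1] 1 by simp
    moreover have 3: "(1 - \<phi> (t l)) / t l \<le> t l * \<alpha> / 2" "0 \<le> (1 - \<phi> (t l)) / t l" for l
      using \<phi>(2,3)[of "t l"] t[of l] by (simp_all add: field_simps power2_eq_square)
    have "((1 - \<phi> (t i)) / t i) * ((1 - \<phi> (t j)) / t j) \<le> (t i * \<alpha> / 2) * (t j * \<alpha> / 2)"
      using 3 t[of i] \<alpha> by (intro mult_mono) auto
    ultimately show ?thesis
      unfolding G u_def by linarith
  qed
  have ti: "((\<lambda>z. t (fst z)) \<longlongrightarrow> 0) (sequentially \<times>\<^sub>F sequentially)"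
    unfolding t_def by (rule filterlim_compose[OF LIMSEQ_inverse_Suc filterlim_fst])
  have tj: "((\<lambda>z. t (snd z)) \<longlongrightarrow> 0) (sequentially \<times>\<^sub>F sequentially)"
    unfolding t_def by (rule filterlim_compose[OF LIMSEQ_inverse_Suc filterlim_snd])
  have l: "((\<lambda>z. \<phi> (t (fst z)) * \<phi> (t (snd z)) * \<alpha>) \<longlongrightarrow> \<alpha>) (sequentially \<times>\<^sub>F sequentially)"
    unfolding \<phi>_def by (rule tendsto_eq_intros ti tj refl | simp)+
  have u: "((\<lambda>z. (t (fst z) * \<alpha> / 2) * (t (snd z) * \<alpha> / 2) + \<alpha> * exp (t (fst z) * t (snd z) * \<alpha>)) \<longlongrightarrow> \<alpha>)
      (sequentially \<times>\<^sub>F sequentially)"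
    by (rule tendsto_eq_intros ti tj refl | simp)+
  show ?thesis
    unfolding \<alpha>_def[symmetric] case_prod_beta
    by (rule tendsto_sandwich[OF _ _ l u]; rule always_eventually; intro allI lower upper)
qed

text \<open>Completeness gives the difference quotients a norm limit, which pointwise convergence
  identifies with \<open>section_deriv x a\<close>. The norm comes from the same convergence:
  pairing with a difference quotient is an evaluation, and the pairings tend to the squared
  norm.\<close>

lemma section_deriv_mem_ip:
  shows section_deriv_mem: "section_deriv x a \<in> H"
    and ip_section_deriv_self: "ip (section_deriv x a) (section_deriv x a) = (norm a)\<^sup>2 / h\<^sup>2"
proof -
  define \<alpha> where "\<alpha> = (norm a)\<^sup>2 / h\<^sup>2"
  define G where "G i j = ip (diff_quot x a i) (diff_quot x a j)" for i j
  have G: "((\<lambda>(i, j). G i j) \<longlongrightarrow> \<alpha>) (sequentially \<times>\<^sub>F sequentially)"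
    unfolding G_def \<alpha>_def by (rule ip_diff_quots_tendsto)
  have Cauchy: "\<exists>N. \<forall>i\<ge>N. \<forall>j\<ge>N. hnorm (\<lambda>y. diff_quot x a i y - diff_quot x a j y) < e"
    if e: "e > 0" for e
  proof -
    have "e\<^sup>2 / 4 > 0"
      using e by simp
    \<comment> \<open>In \<open>G i i - 2 * G i j + G j j\<close> the three errors enter with
      weights 1, 2, 1, hence a quarter of \<open>e\<^sup>2\<close> for each unit.\<close>
    from tendstoD[OF G this] obtain N where N:
      "\<And>i j. i \<ge> N \<Longrightarrow> j \<ge> N \<Longrightarrow> \<bar>G i j - \<alpha>\<bar> < e\<^sup>2 / 4"
      unfolding eventually_prod_sequentially dist_real_def by auto
    have "hnorm (\<lambda>y. diff_quot x a i y - diff_quot x a j y) < e" if "i \<ge> N" "j \<ge> N" for i j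
    proof -
      have "G i i - 2 * G i j + G j j < e\<^sup>2"
        using N[of i i] N[of i j] N[of j j] that by linarith
      then have "sqrt (ip (\<lambda>y. diff_quot x a i y - diff_quot x a j y)
          (\<lambda>y. diff_quot x a i y - diff_quot x a j y)) < sqrt (e\<^sup>2)"
        unfolding ip_diff_self[OF diff_quot_mem diff_quot_mem] G_def by (rule real_sqrt_less_mono)
      then show ?thesis
        unfolding hnorm_def using e by simp
    qed
    then show ?thesis
      by blast
  qed
  obtain g where g: "g \<in> H" and lim: "(\<lambda>n. hnorm (\<lambda>y. diff_quot x a n y - g y)) \<longlonglongrightarrow> 0"
    using complete_hnorm[of "diff_quot x a", OF diff_quot_mem Cauchy] by blast
  have "g = section_deriv x a"
  proof
    fix y
    have "(\<lambda>n. diff_quot x a n y) \<longlonglongrightarrow> g y"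
      by (rule hnorm_tendsto_eval[OF diff_quot_mem g lim])
    moreover have "(\<lambda>n. diff_quot x a n y) \<longlonglongrightarrow> section_deriv x a y"
      using deriv_imp_diff_quot_tendsto[of "\<lambda>z. rbf h z y", OF rbf_has_derivative_along] .
    ultimately show "g y = section_deriv x a y"
      by (rule LIMSEQ_unique)
  qed
  with g lim have mem: "section_deriv x a \<in> H"
    and lim': "(\<lambda>n. hnorm (\<lambda>y. diff_quot x a n y - section_deriv x a y)) \<longlonglongrightarrow> 0"
    by auto
  show "section_deriv x a \<in> H"
    by (rule mem)
  have "(\<lambda>n. ip (section_deriv x a) (diff_quot x a n)) \<longlonglongrightarrow> ip (section_deriv x a) (section_deriv x a)"
  proof -
    have "(\<lambda>n. ip (section_deriv x a) (\<lambda>y. diff_quot x a n y - section_deriv x a y)) \<longlonglongrightarrow> 0"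
    proof (rule Lim_null_comparison)
      show "\<forall>\<^sub>F n in sequentially. norm (ip (section_deriv x a) (\<lambda>y. diff_quot x a n y - section_deriv x a y))
          \<le> hnorm (section_deriv x a) * hnorm (\<lambda>y. diff_quot x a n y - section_deriv x a y)"
        unfolding real_norm_def
        by (intro always_eventually allI cauchy_schwarz mem diff_mem diff_quot_mem)
      show "(\<lambda>n. hnorm (section_deriv x a) * hnorm (\<lambda>y. diff_quot x a n y - section_deriv x a y)) \<longlonglongrightarrow> 0"
        using tendsto_mult_right_zero[OF lim'] by simp
    qed
    then show ?thesis
      by (simp only: ip_diff_right[OF diff_quot_mem mem mem] LIM_zero_iff)
  qed
  moreover have "(\<lambda>n. ip (section_deriv x a) (diff_quot x a n)) \<longlonglongrightarrow> (norm a)\<^sup>2 / h\<^sup>2"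
  proof -
    let ?t = "\<lambda>n. inverse (real (Suc n))"
    \<comment> \<open>\<open>section_deriv x a\<close> vanishes at \<open>x\<close>, so only the
      shifted evaluation survives, and its factor \<open>?t n\<close> cancels
      \<open>Suc n\<close>.\<close>
    have eq: "ip (section_deriv x a) (diff_quot x a n) = exp (- ((?t n)\<^sup>2 * \<alpha> / 2)) * \<alpha>" for n
    proof -
      have "ip (section_deriv x a) (diff_quot x a n)
          = real (Suc n) * (rbf h (x + ?t n *\<^sub>R a) x * (?t n * (a \<bullet> a) / h\<^sup>2))"
        unfolding ip_diff_quot[OF mem]
        by (simp add: section_deriv_def rbf_commute[of x "x + _"] del: of_nat_Suc)
      also have "\<dots> = (real (Suc n) * ?t n) * (rbf h (x + ?t n *\<^sub>R a) x * \<alpha>)"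
        unfolding \<alpha>_def power2_norm_eq_inner by (simp only: mult_ac times_divide_eq_right times_divide_eq_left)
      also have "real (Suc n) * ?t n = 1"
        by simp
      finally show ?thesis
        unfolding rbf_shift0 \<alpha>_def[symmetric] mult_1 .
    qed
    have "(\<lambda>n. exp (- ((t n)\<^sup>2 * \<alpha> / 2)) * \<alpha>) \<longlonglongrightarrow> exp (- (0\<^sup>2 * \<alpha> / 2)) * \<alpha>"
      if "t \<longlonglongrightarrow> 0" for t :: "nat \<Rightarrow> real"
      using that by (intro tendsto_intros) auto
    from this[OF LIMSEQ_inverse_Suc] show ?thesis
      unfolding eq by (simp only: \<alpha>_def power_zero_numeral mult_zero_left div_0 minus_zero exp_zero mult_1)
  qed
  ultimately show "ip (section_deriv x a) (section_deriv x a) = (norm a)\<^sup>2 / h\<^sup>2"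
    by (rule LIMSEQ_unique)
qed

lemma hnorm_section_deriv: "hnorm (section_deriv x a) = norm a / h"
  using h_pos by (simp add: hnorm_def ip_section_deriv_self real_sqrt_divide)

lemma abs_ip_section_deriv_le:
  "f \<in> H \<Longrightarrow> \<bar>ip f (section_deriv x a)\<bar> \<le> hnorm f * norm a / h"
  using cauchy_schwarz[OF _ section_deriv_mem, of f x a] by (simp add: hnorm_section_deriv)

section \<open>Differentiability of the members of the Gaussian space\<close>

lemma hnorm_taylor_le:
  "hnorm (\<lambda>y. (rbf h (x + a) y - rbf h x y) - section_deriv x a y) \<le> (norm a)\<^sup>2 / h\<^sup>2"
proof -
  define \<alpha> where "\<alpha> = (norm a)\<^sup>2 / h\<^sup>2"
  have \<alpha>: "\<alpha> \<ge> 0"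
    by (simp add: \<alpha>_def)
  define e where "e = exp (- (\<alpha> / 2))"
  have e: "e \<ge> 1 - \<alpha> / 2"
    using exp_ge_add_one_self[of "- (\<alpha> / 2)"] by (simp add: e_def)
  have rbf_e: "rbf h (x + a) x = e"
    using rbf_shift0[of x 1 a] by (simp add: e_def \<alpha>_def)
  have "ip (\<lambda>y. rbf h (x + a) y - rbf h x y) (\<lambda>y. rbf h (x + a) y - rbf h x y) = 2 - 2 * e"
    by (simp add: ip_diff_self section_mem ip_sections rbf_e)
  moreover have "ip (\<lambda>y. rbf h (x + a) y - rbf h x y) (section_deriv x a) = e * \<alpha>"
    unfolding ip_diff[OF section_mem section_mem section_deriv_mem] ip_section[OF section_deriv_mem]
    by (simp add: section_deriv_def rbf_commute[of x] rbf_e \<alpha>_def power2_norm_eq_inner)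
  ultimately have "ip (\<lambda>y. (rbf h (x + a) y - rbf h x y) - section_deriv x a y)
      (\<lambda>y. (rbf h (x + a) y - rbf h x y) - section_deriv x a y) = 2 - 2 * e - 2 * (e * \<alpha>) + \<alpha>"
    by (simp add: ip_diff_self diff_mem section_mem section_deriv_mem ip_section_deriv_self \<alpha>_def)
  also have "\<dots> \<le> \<alpha>\<^sup>2"
    using e mult_right_mono[OF e \<alpha>] by (simp add: power2_eq_square algebra_simps)
  finally show ?thesis
    unfolding hnorm_def \<alpha>_def[symmetric] using \<alpha> by (rule real_le_lsqrt[rotated])
qed

lemma section_deriv_add: "section_deriv x (a + b) = (\<lambda>y. section_deriv x a y + section_deriv x b y)"
  by (simp add: section_deriv_def fun_eq_iff inner_left_distrib add_divide_distrib distrib_left)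

lemma section_deriv_scaleR: "section_deriv x (c *\<^sub>R a) = (\<lambda>y. c * section_deriv x a y)"
  by (simp add: section_deriv_def fun_eq_iff)

lemma bounded_linear_ip_section_deriv:
  assumes f: "f \<in> H"
  shows "bounded_linear (\<lambda>a. ip f (section_deriv x a))"
proof (rule bounded_linear_intro)
  show "ip f (section_deriv x (a + b)) = ip f (section_deriv x a) + ip f (section_deriv x b)" for a b
    by (simp add: section_deriv_add ip_add_right f section_deriv_mem)
  show "ip f (section_deriv x (c *\<^sub>R a)) = c *\<^sub>R ip f (section_deriv x a)" for c a
    by (simp add: section_deriv_scaleR ip_scale_right f section_deriv_mem)
  show "norm (ip f (section_deriv x a)) \<le> norm a * (hnorm f / h)" for a
    using abs_ip_section_deriv_le[OF f, of x a] by (simp add: mult.commute)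
qed

text \<open>The remainder of \<open>f\<close> is its pairing with the Taylor remainder of the kernel
  section. One second-order norm estimate for sections thus controls all members of the space
  through Cauchy-Schwarz.\<close>

lemma has_derivative_mem:
  assumes f: "f \<in> H"
  shows "(f has_derivative (\<lambda>a. ip f (section_deriv x a))) (at x)"
proof (rule has_derivativeI_sandwich[of 1])
  show "bounded_linear (\<lambda>a. ip f (section_deriv x a))"
    by (rule bounded_linear_ip_section_deriv[OF f])
  show "norm ((f y - f x) - ip f (section_deriv x (y - x))) / norm (y - x)
      \<le> hnorm f * norm (y - x) / h\<^sup>2" if "y \<noteq> x" for y
  proof -
    define R where "R = (\<lambda>z. (rbf h (x + (y - x)) z - rbf h x z) - section_deriv x (y - x) z)"
    have R: "R \<in> H"
      unfolding R_def by (rule diff_mem[OF diff_mem[OF section_mem section_mem] section_deriv_mem])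
    have "(f y - f x) - ip f (section_deriv x (y - x)) = ip f R"
      unfolding R_def ip_diff_right[OF diff_mem[OF section_mem section_mem] section_deriv_mem f]
        ip_diff_right[OF section_mem section_mem f] reproducing[OF f, symmetric] by simp
    then have "\<bar>(f y - f x) - ip f (section_deriv x (y - x))\<bar> \<le> hnorm f * hnorm R"
      using cauchy_schwarz[OF f R] by simp
    also have "\<dots> \<le> hnorm f * ((norm (y - x))\<^sup>2 / h\<^sup>2)"
      unfolding R_def by (intro mult_left_mono hnorm_taylor_le hnorm_nonneg f)
    finally have "norm ((f y - f x) - ip f (section_deriv x (y - x))) / norm (y - x)
        \<le> hnorm f * ((norm (y - x))\<^sup>2 / h\<^sup>2) / norm (y - x)"
      unfolding real_norm_def by (rule divide_right_mono) simp
    also have "\<dots> = hnorm f * norm (y - x) / h\<^sup>2"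
      using that by (simp add: power2_eq_square)
    finally show ?thesis .
  qed
  show "((\<lambda>y. hnorm f * norm (y - x) / h\<^sup>2) \<longlongrightarrow> 0) (at x)"
  proof -
    have "((\<lambda>y. hnorm f * norm (y - x) / h\<^sup>2) \<longlongrightarrow> hnorm f * norm (x - x) / h\<^sup>2) (at x)"
      using h_pos by (intro tendsto_intros) auto
    then show ?thesis
      by simp
  qed
qed simp

lemma borel_measurable_mem:
  assumes "f \<in> H"
  shows "f \<in> borel_measurable borel"
proof (rule borel_measurable_continuous_onI)
  show "continuous_on UNIV f"
    using has_derivative_continuous[OF has_derivative_mem[OF assms]]
    by (simp add: continuous_on_eq_continuous_at)
qed

lemma has_derivative_along_mem:
  assumes "f \<in> H"
  shows "((\<lambda>t. f (x + t *\<^sub>R a)) has_real_derivative ip f (section_deriv x a)) (at 0)"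
proof -
  have "((\<lambda>t. x + t *\<^sub>R a) has_derivative (\<lambda>t. t *\<^sub>R a)) (at 0)"
    by (auto intro!: derivative_eq_intros)
  from has_derivative_compose[OF this, of f "\<lambda>a. ip f (section_deriv x a)"]
  have "((\<lambda>t. f (x + t *\<^sub>R a)) has_derivative (\<lambda>t. ip f (section_deriv x (t *\<^sub>R a)))) (at 0)"
    using has_derivative_mem[OF assms] by simp
  then show ?thesis
    by (simp add: has_field_derivative_def section_deriv_scaleR ip_scale_right assms
        section_deriv_mem mult.commute[of _ "ip f (section_deriv x a)"])
qed

text \<open>For fixed \<open>a\<close> this is a directional derivative of \<open>f\<close>, a
  pointwise limit of difference quotients that are measurable in \<open>x\<close>.\<close>

lemma borel_measurable_ip_section_deriv:
  assumes f: "f \<in> H"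
  shows "(\<lambda>x. ip f (section_deriv x a)) \<in> borel_measurable borel"
proof (rule borel_measurable_LIMSEQ_real)
  show "(\<lambda>n. real (Suc n) * (f (x + inverse (real (Suc n)) *\<^sub>R a) - f x))
      \<longlonglongrightarrow> ip f (section_deriv x a)" for x
    by (rule deriv_imp_diff_quot_tendsto[OF has_derivative_along_mem[OF f]])
  show "(\<lambda>x. real (Suc n) * (f (x + inverse (real (Suc n)) *\<^sub>R a) - f x)) \<in> borel_measurable borel" for n
    using borel_measurable_mem[OF f] by measurable
qed

end

section \<open>Integrals of directional derivatives\<close>

lemma lborel_distr_plus_right:
  fixes c :: "'a::euclidean_space"
  shows "distr lborel borel (\<lambda>x. x + c) = lborel"
proof -
  have "(+) c = (\<lambda>x. x + c)"
    by (simp add: fun_eq_iff add.commute)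
  then show ?thesis
    using lborel_distr_plus[of c] by simp
qed

lemma integral_translate:
  fixes f :: "'a::euclidean_space \<Rightarrow> real"
  assumes [measurable]: "f \<in> borel_measurable borel"
  shows "(LINT x|lborel. f (x + c)) = integral\<^sup>L lborel f"
    and "integrable lborel (\<lambda>x. f (x + c)) \<longleftrightarrow> integrable lborel f"
proof -
  note d = lborel_distr_plus_right[of c]
  show "(LINT x|lborel. f (x + c)) = integral\<^sup>L lborel f"
    using integral_distr[of "\<lambda>x. x + c" lborel borel f] by (simp add: d)
  show "integrable lborel (\<lambda>x. f (x + c)) \<longleftrightarrow> integrable lborel f"
    using integrable_distr_eq[of "\<lambda>x. x + c" lborel borel f] by (simp add: d)
qed

lemma nn_integral_translate:
  fixes f :: "'a::euclidean_space \<Rightarrow> ennreal"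
  assumes [measurable]: "f \<in> borel_measurable borel"
  shows "(\<integral>\<^sup>+x. f (x + c) \<partial>lborel) = integral\<^sup>N lborel f"
proof -
  note d = lborel_distr_plus_right[of c]
  show ?thesis
    using nn_integral_distr[of "\<lambda>x. x + c" lborel borel f] by (simp add: d)
qed

text \<open>Translation invariance gives \<open>0 = \<integral> W (x + c) - W x dx\<close>; writing the integrand as
  \<open>\<integral>\<^sub>0\<^sup>1 W' (x + s c) ds\<close> for almost every \<open>x\<close> and exchanging the integrals yields \<open>\<integral> W' = 0\<close>.
  No continuity of the derivative is needed, because the Henstock--Kurzweil fundamental theorem
  applies to every derivative.\<close>

lemma integral_directional_derivative_eq_0:
  fixes W W' :: "'a::euclidean_space \<Rightarrow> real"
  assumes W: "integrable lborel W" and W': "integrable lborel W'"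
    and deriv: "\<And>x. ((\<lambda>s. W (x + s *\<^sub>R c)) has_real_derivative W' x) (at 0)"
  shows "integral\<^sup>L lborel W' = 0"
proof -
  have [measurable]: "W \<in> borel_measurable borel" "W' \<in> borel_measurable borel"
    using W W' by (auto dest: borel_measurable_integrable)
  let ?I = "{0..1::real}"
  define f where "f x s = indicator ?I s * W' (x + s *\<^sub>R c)" for x s
  have [measurable]: "case_prod f \<in> borel_measurable (lborel \<Otimes>\<^sub>M lborel)"
    unfolding f_def by measurable
  have "(\<integral>\<^sup>+ z. norm (case_prod f z) \<partial>(lborel \<Otimes>\<^sub>M lborel))
      = (\<integral>\<^sup>+ s. (\<integral>\<^sup>+ x. norm (f x s) \<partial>lborel) \<partial>lborel)"
    by (subst lborel_pair.nn_integral_snd[symmetric]) auto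
  also have "\<dots> = (\<integral>\<^sup>+ s. indicator ?I s * (\<integral>\<^sup>+ x. norm (W' x) \<partial>lborel) \<partial>lborel)"
  proof (intro nn_integral_cong)
    fix s :: real
    have "(\<integral>\<^sup>+ x. norm (f x s) \<partial>lborel)
        = (\<integral>\<^sup>+ x. indicator ?I s * ennreal (norm (W' (x + s *\<^sub>R c))) \<partial>lborel)"
      by (intro nn_integral_cong) (auto simp: f_def split: split_indicator)
    also have "\<dots> = indicator ?I s * (\<integral>\<^sup>+ x. norm (W' (x + s *\<^sub>R c)) \<partial>lborel)"
      by (subst nn_integral_cmult) auto
    also have "(\<integral>\<^sup>+ x. norm (W' (x + s *\<^sub>R c)) \<partial>lborel) = (\<integral>\<^sup>+ x. norm (W' x) \<partial>lborel)"
      by (rule nn_integral_translate) simp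
    finally show "(\<integral>\<^sup>+ x. norm (f x s) \<partial>lborel)
        = indicator ?I s * (\<integral>\<^sup>+ x. norm (W' x) \<partial>lborel)" .
  qed
  also have "\<dots> = (\<integral>\<^sup>+ x. norm (W' x) \<partial>lborel)"
    by (subst nn_integral_multc) auto
  also have "\<dots> < \<infinity>"
    using W' by (simp add: integrable_iff_bounded)
  finally have int_f: "integrable (lborel \<Otimes>\<^sub>M lborel) (case_prod f)"
    by (intro integrableI_bounded) auto
  \<comment> \<open>\<open>deriv\<close> speaks about parameter 0 only, but for every base point;
    recentring at \<open>x + t c\<close> differentiates along the whole line.\<close>
  have line: "((\<lambda>s. W (x + s *\<^sub>R c)) has_vector_derivative W' (x + t *\<^sub>R c)) (at t)" for x t
  proof -
    have "((\<lambda>s. W ((x + t *\<^sub>R c) + (s - t) *\<^sub>R c)) has_real_derivative W' (x + t *\<^sub>R c)) (at t)"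
      using DERIV_shift[of "\<lambda>s. W ((x + t *\<^sub>R c) + s *\<^sub>R c)" _ t "-t"] deriv[of "x + t *\<^sub>R c"]
      by simp
    then show ?thesis
      by (simp add: has_real_derivative_iff_has_vector_derivative algebra_simps)
  qed
  \<comment> \<open>Integrability of the section lets the Lebesgue integral be replaced by the gauge
    integral, to which the fundamental theorem applies. Fubini provides it for almost every
    \<open>x\<close>.\<close>
  have inner: "(LINT s|lborel. f x s) = W (x + c) - W x" if "integrable lborel (f x)" for x
  proof -
    have s: "set_integrable lborel ?I (\<lambda>s. W' (x + s *\<^sub>R c))"
      using that unfolding set_integrable_def f_def by simp
    have "(LINT s|lborel. f x s) = (LINT s:?I|lborel. W' (x + s *\<^sub>R c))"
      by (simp add: set_lebesgue_integral_def f_def)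
    also have "\<dots> = integral ?I (\<lambda>s. W' (x + s *\<^sub>R c))"
      by (rule set_borel_integral_eq_integral[OF s])
    also have "\<dots> = W (x + 1 *\<^sub>R c) - W (x + 0 *\<^sub>R c)"
      by (intro integral_unique fundamental_theorem_of_calculus)
        (auto intro: has_vector_derivative_at_within line)
    finally show ?thesis
      by simp
  qed
  have "(LINT x|lborel. (LINT s|lborel. f x s)) = (LINT x|lborel. W (x + c) - W x)"
  proof (rule integral_cong_AE)
    show "AE x in lborel. (LINT s|lborel. f x s) = W (x + c) - W x"
      using lborel_pair.AE_integrable_fst[OF int_f] by eventually_elim (rule inner)
  qed measurable
  also have "\<dots> = 0"
    using W integral_translate[of W c] by simp
  finally have "(LINT s|lborel. (LINT x|lborel. f x s)) = 0"
    using lborel_pair.Fubini_integral[OF int_f] by simp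
  also have "(LINT s|lborel. (LINT x|lborel. f x s))
      = (LINT s|lborel. indicator ?I s * integral\<^sup>L lborel W')"
    using integral_translate(1)[of W'] by (simp add: f_def)
  also have "\<dots> = integral\<^sup>L lborel W'"
    by simp
  finally show ?thesis .
qed

section \<open>Steepest ascent\<close>

lemma integrable_componentwiseI:
  fixes f :: "'a \<Rightarrow> 'b::euclidean_space"
  assumes "\<And>b. b \<in> Basis \<Longrightarrow> integrable M (\<lambda>x. f x \<bullet> b)"
  shows "integrable M f"
proof -
  have "integrable M (\<lambda>x. \<Sum>b\<in>Basis. (f x \<bullet> b) *\<^sub>R b)"
    using assms by (intro Bochner_Integration.integrable_sum integrable_scaleR_left) auto
  then show ?thesis
    by (simp add: euclidean_representation)
qed

lemma integrable_bounded_mult: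
  fixes f g :: "'a \<Rightarrow> real"
  assumes [measurable]: "f \<in> borel_measurable M" and f: "\<And>x. \<bar>f x\<bar> \<le> C"
    and g: "integrable M g"
  shows "integrable M (\<lambda>x. f x * g x)"
proof (rule Bochner_Integration.integrable_bound)
  have [measurable]: "g \<in> borel_measurable M"
    using g by simp
  show "(\<lambda>x. f x * g x) \<in> borel_measurable M"
    by measurable
  show "integrable M (\<lambda>x. C * \<bar>g x\<bar>)"
    using g by simp
  show "AE x in M. norm (f x * g x) \<le> norm (C * \<bar>g x\<bar>)"
  proof (rule AE_I2)
    fix x
    have "\<bar>f x\<bar> \<le> \<bar>C\<bar>"
      using f[of x] by linarith
    then show "norm (f x * g x) \<le> norm (C * \<bar>g x\<bar>)"
      by (simp add: abs_mult mult_right_mono)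
  qed
qed

lemma prob_density_measurable:
  "prob_density q \<Longrightarrow> q \<in> borel_measurable borel"
  by (auto simp: prob_density_def dest: borel_measurable_integrable)

lemma finite_measure_law:
  fixes q :: "'a::euclidean_space \<Rightarrow> real"
  assumes q: "prob_density q"
  shows "finite_measure (law q)"
proof
  have [measurable]: "q \<in> borel_measurable borel"
    by (rule prob_density_measurable[OF q])
  have "emeasure (law q) (space (law q)) = (\<integral>\<^sup>+x. ennreal (q x) \<partial>lborel)"
    by (subst emeasure_density) auto
  also have "\<dots> = 1"
    using q by (simp add: nn_integral_eq_integral prob_density_def)
  finally show "emeasure (law q) (space (law q)) \<noteq> \<infinity>"
    by simp
qed

lemma grad_miss_inner_Basis:
  "b \<in> Basis \<Longrightarrow> grad_miss f x \<bullet> b = frechet_derivative (\<lambda>z. f (z, snd x)) (at (fst x)) b"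
  unfolding grad_miss_def by (rule inner_sum_left_Basis)

lemma grad_miss_inner_eq:
  assumes "((\<lambda>z. f (z, snd x)) has_derivative D) (at (fst x))" "b \<in> Basis"
  shows "grad_miss f x \<bullet> b = D b"
  unfolding grad_miss_inner_Basis[OF assms(2)] frechet_derivative_at[OF assms(1), symmetric] ..

lemma div_miss_eq_sum_grad_miss:
  assumes "(\<lambda>z. v (z, snd x)) differentiable (at (fst x))"
  shows "div_miss v x = (\<Sum>b\<in>Basis. grad_miss (\<lambda>y. v y \<bullet> b) x \<bullet> b)"
proof -
  obtain D where D: "((\<lambda>z. v (z, snd x)) has_derivative D) (at (fst x))"
    using assms by (auto simp: differentiable_def)
  have "grad_miss (\<lambda>y. v y \<bullet> b) x \<bullet> b = D b \<bullet> b" if "b \<in> Basis" for b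
    by (rule grad_miss_inner_eq[OF has_derivative_inner_left[OF D] that])
  then show ?thesis
    unfolding div_miss_def frechet_derivative_at[OF D, symmetric] by simp
qed

text \<open>If the rate is the pairing with \<open>u\<close>, the objective at \<open>u\<close>
  exceeds the one at \<open>v\<close> by half the squared distance of \<open>u\<close> and
  \<open>v\<close>. A second maximiser is therefore at distance 0, and \<open>ip_definite\<close>
  makes it equal to \<open>u\<close> at every point, not only almost everywhere.\<close>

lemma (in rkhs) is_arg_max_regularised_linear:
  fixes u :: "'a \<Rightarrow> 'm::euclidean_space"
  assumes u: "u \<in> vfields H"
    and R: "\<And>v. v \<in> vfields H \<Longrightarrow> R v = (\<Sum>b\<in>Basis. ip (\<lambda>x. v x \<bullet> b) (\<lambda>x. u x \<bullet> b))"
  shows "is_arg_max (\<lambda>v. R v - 1/2 * vnorm_sq ip v) (\<lambda>v. v \<in> vfields H) u"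
    and "is_arg_max (\<lambda>v. R v - 1/2 * vnorm_sq ip v) (\<lambda>v. v \<in> vfields H) v \<Longrightarrow> v = u"
proof -
  let ?J = "\<lambda>v. R v - 1/2 * vnorm_sq ip v"
  let ?d = "\<lambda>v b. ip (\<lambda>x. v x \<bullet> b - u x \<bullet> b) (\<lambda>x. v x \<bullet> b - u x \<bullet> b)"
  have comp: "(\<lambda>x. v x \<bullet> b) \<in> H" if "v \<in> vfields H" "b \<in> Basis" for v :: "'a \<Rightarrow> 'm" and b
    using that by (simp add: vfields_def)
  have J: "?J u - ?J v = 1/2 * (\<Sum>b\<in>Basis. ?d v b)" if v: "v \<in> vfields H" for v
  proof -
    have "(\<Sum>b\<in>Basis. ?d v b) = (\<Sum>b\<in>Basis. ip (\<lambda>x. v x \<bullet> b) (\<lambda>x. v x \<bullet> b)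
        - 2 * ip (\<lambda>x. v x \<bullet> b) (\<lambda>x. u x \<bullet> b) + ip (\<lambda>x. u x \<bullet> b) (\<lambda>x. u x \<bullet> b))"
      by (intro sum.cong refl ip_diff_self comp u v)
    also have "\<dots> = vnorm_sq ip v - 2 * R v + vnorm_sq ip u"
      unfolding R[OF v] vnorm_sq_def by (simp add: sum.distrib sum_subtractf sum_distrib_left)
    moreover have "R u = vnorm_sq ip u"
      unfolding vnorm_sq_def by (rule R[OF u])
    ultimately show ?thesis
      by simp
  qed
  have d_nonneg: "0 \<le> ?d v b" if "v \<in> vfields H" "b \<in> Basis" for v b
    by (intro ip_nonneg diff_mem comp u that)
  have le: "?J v \<le> ?J u" if "v \<in> vfields H" for v
  proof -
    have "0 \<le> (\<Sum>b\<in>Basis. ?d v b)"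
      by (intro sum_nonneg d_nonneg that)
    then show ?thesis
      using J[OF that] by linarith
  qed
  show arg: "is_arg_max ?J (\<lambda>v. v \<in> vfields H) u"
    unfolding is_arg_max_linorder by (intro conjI allI impI u le)
  show "v = u" if "is_arg_max ?J (\<lambda>v. v \<in> vfields H) v"
  proof -
    have v: "v \<in> vfields H" and "\<not> ?J v < ?J u"
      using that u by (auto simp: is_arg_max_def)
    moreover have "0 \<le> (\<Sum>b\<in>Basis. ?d v b)"
      by (intro sum_nonneg d_nonneg v)
    ultimately have "(\<Sum>b\<in>Basis. ?d v b) = 0"
      using J[OF v] by linarith
    then have "?d v b = 0" if "b \<in> Basis" for b
      using sum_nonneg_eq_0_iff[of Basis "?d v"] d_nonneg[OF v] that by simp
    then have "(\<lambda>x. v x \<bullet> b - u x \<bullet> b) = (\<lambda>x. 0)" if "b \<in> Basis" for b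
      using that by (intro ip_definite diff_mem comp u v)
    then have eq: "v x \<bullet> b = u x \<bullet> b" if "b \<in> Basis" for x b
      using fun_cong[of "\<lambda>x. v x \<bullet> b - u x \<bullet> b" "\<lambda>x. 0" x] that by simp
    show ?thesis
      by (rule ext, rule euclidean_eqI, rule eq)
  qed
qed

section \<open>Riesz representation of the scalar rate functionals\<close>

context gaussian_rkhs
begin

lemma integrable_mult_mem:
  assumes "sets M = sets borel" and f: "f \<in> H" and g: "integrable M g"
  shows "integrable M (\<lambda>x. f x * g x)"
  using borel_measurable_mem[OF f] assms(1) abs_le_hnorm[OF f] g
  by (intro integrable_bounded_mult) (auto cong: measurable_cong_sets)

lemma integrable_ip_section_deriv:
  assumes "finite_measure M" "sets M = sets borel" and f: "f \<in> H"
  shows "integrable M (\<lambda>x. ip f (section_deriv x c))"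
proof -
  interpret finite_measure M
    by fact
  show ?thesis
  proof (rule integrable_const_bound[of _ "hnorm f * norm c / h"])
    show "AE x in M. norm (ip f (section_deriv x c)) \<le> hnorm f * norm c / h"
      using abs_ip_section_deriv_le[OF f] by simp
    show "(\<lambda>x. ip f (section_deriv x c)) \<in> borel_measurable M"
      using borel_measurable_ip_section_deriv[OF f] assms(2) by (simp cong: measurable_cong_sets)
  qed
qed

text \<open>That the function built from the values at sections belongs to \<open>H\<close> is not
  visible from the integral. The Riesz representer \<open>u\<close> belongs to \<open>H\<close> by
  construction, and \<open>u x\<close> is its pairing with \<open>rbf h x\<close>, so the two
  coincide.\<close>

lemma stein_representer_mem:
  fixes g :: "'a \<Rightarrow> real" and lam :: real and c :: 'a
  assumes M: "finite_measure M" "sets M = sets borel" and g: "integrable M g"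
  defines "L \<equiv> \<lambda>f. LINT y|M. f y * g y - lam * ip f (section_deriv y c)"
  shows "(\<lambda>x. L (rbf h x)) \<in> H"
    and "f \<in> H \<Longrightarrow> L f = ip f (\<lambda>x. L (rbf h x))"
proof -
  note int = integrable_mult_mem[OF M(2) _ g] integrable_ip_section_deriv[OF M]
  have L: "L f = (LINT y|M. f y * g y) - lam * (LINT y|M. ip f (section_deriv y c))"
    if "f \<in> H" for f
    unfolding L_def using int[OF that] by simp
  \<comment> \<open>The first summand uses the bound of \<open>f\<close> by its norm; the second
    uses the derivative bound \<open>hnorm f * norm c / h\<close> integrated over the finite mass of
    \<open>M\<close>.\<close>
  define C where "C = (LINT y|M. \<bar>g y\<bar>) + \<bar>lam\<bar> * (norm c / h * measure M (space M))"
  obtain u where u: "u \<in> H" "\<And>f. f \<in> H \<Longrightarrow> L f = ip f u"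
  proof (rule riesz_representation)
    show "L (\<lambda>x. f x + e x) = L f + L e" if "f \<in> H" "e \<in> H" for f e
      using int that
      by (simp add: L add_mem ip_add section_deriv_mem distrib_left distrib_right)
    show "L (\<lambda>x. a * f x) = a * L f" if "f \<in> H" for a f
      using int that
      by (simp add: L scale_mem ip_scale section_deriv_mem right_diff_distrib mult.assoc mult.left_commute)
    show "\<bar>L f\<bar> \<le> C * hnorm f" if f: "f \<in> H" for f
    proof -
      have "\<bar>LINT y|M. f y * g y\<bar> \<le> (LINT y|M. \<bar>f y * g y\<bar>)"
        by (rule integral_abs_bound)
      also have "\<dots> \<le> (LINT y|M. hnorm f * \<bar>g y\<bar>)"
        using g abs_le_hnorm[OF f]
        by (intro integral_mono integrable_abs int(1)[OF f]) (auto simp: abs_mult mult_right_mono)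
      also have "\<dots> = hnorm f * (LINT y|M. \<bar>g y\<bar>)"
        by simp
      finally have 1: "\<bar>LINT y|M. f y * g y\<bar> \<le> hnorm f * (LINT y|M. \<bar>g y\<bar>)" .
      have "\<bar>LINT y|M. ip f (section_deriv y c)\<bar> \<le> (LINT y|M. \<bar>ip f (section_deriv y c)\<bar>)"
        by (rule integral_abs_bound)
      also have "\<dots> \<le> (LINT y|M. hnorm f * norm c / h)"
        using int(2)[OF f, of c] abs_ip_section_deriv_le[OF f] M(1)
        by (intro integral_mono) (auto intro: finite_measure.integrable_const)
      also have "\<dots> = hnorm f * (norm c / h * measure M (space M))"
        by simp
      finally have 2: "\<bar>LINT y|M. ip f (section_deriv y c)\<bar> \<le> hnorm f * (norm c / h * measure M (space M))" .
      have "\<bar>L f\<bar> \<le> \<bar>LINT y|M. f y * g y\<bar> + \<bar>lam\<bar> * \<bar>LINT y|M. ip f (section_deriv y c)\<bar>"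
        unfolding L[OF f] abs_mult[symmetric] by (rule abs_triangle_ineq4)
      also have "\<dots> \<le> hnorm f * (LINT y|M. \<bar>g y\<bar>) + \<bar>lam\<bar> * (hnorm f * (norm c / h * measure M (space M)))"
        using 1 2 by (intro add_mono mult_left_mono) auto
      also have "\<dots> = C * hnorm f"
        by (simp add: C_def algebra_simps)
      finally show ?thesis .
    qed
  qed blast
  have "(\<lambda>x. L (rbf h x)) = u"
    using u(2)[OF section_mem] ip_section[OF u(1)] by (simp add: fun_eq_iff)
  then show "(\<lambda>x. L (rbf h x)) \<in> H" "f \<in> H \<Longrightarrow> L f = ip f (\<lambda>x. L (rbf h x))"
    using u by auto
qed

end

section \<open>Vector fields on pairs and the regularised maximiser\<close>

locale gaussian_rkhs_pair = gaussian_rkhs h H ip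
  for h and H :: "('m::euclidean_space \<times> 'o::euclidean_space \<Rightarrow> real) set" and ip
begin

lemma has_derivative_miss_mem:
  assumes "f \<in> H"
  shows "((\<lambda>z. f (z, snd x)) has_derivative (\<lambda>a. ip f (section_deriv x (a, 0)))) (at (fst x))"
proof -
  have "((\<lambda>z. (z, snd x)) has_derivative (\<lambda>a. (a, 0))) (at (fst x))"
    by (auto intro!: derivative_eq_intros)
  from has_derivative_compose[OF this, of f "\<lambda>a. ip f (section_deriv x a)"]
  show ?thesis
    using has_derivative_mem[OF assms, of x] by simp
qed

lemma grad_miss_mem:
  "f \<in> H \<Longrightarrow> b \<in> Basis \<Longrightarrow> grad_miss f x \<bullet> b = ip f (section_deriv x (b, 0))"
  by (rule grad_miss_inner_eq[OF has_derivative_miss_mem])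

lemma differentiable_vfield:
  fixes v :: "'m \<times> 'o \<Rightarrow> 'm"
  assumes "v \<in> vfields H"
  shows "(\<lambda>z. v (z, snd x)) differentiable (at (fst x))"
proof (rule iffD2[OF differentiable_componentwise_within], rule ballI)
  fix b :: 'm
  assume "b \<in> Basis"
  then have "(\<lambda>y. v y \<bullet> b) \<in> H"
    using assms by (simp add: vfields_def)
  from has_derivative_miss_mem[OF this, of x]
  show "(\<lambda>z. v (z, snd x) \<bullet> b) differentiable (at (fst x))"
    by (auto simp: differentiable_def)
qed

lemma div_miss_vfield:
  fixes v :: "'m \<times> 'o \<Rightarrow> 'm"
  assumes "v \<in> vfields H"
  shows "div_miss v x = (\<Sum>b\<in>Basis. ip (\<lambda>y. v y \<bullet> b) (section_deriv x (b, 0)))"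
  unfolding div_miss_eq_sum_grad_miss[OF differentiable_vfield[OF assms]]
  using assms by (intro sum.cong refl grad_miss_mem) (auto simp: vfields_def)

lemma joint_NER_steepest_ascent:
  fixes phat q :: "'m \<times> 'o \<Rightarrow> real" and lam :: real
  assumes q: "prob_density q"
    and score: "integrable (law q) (grad_miss (\<lambda>x. ln (phat x)))"
  defines "R \<equiv> joint_NER_rate phat lam q" and "u \<equiv> joint_NER_velocity phat lam h q"
  shows "is_arg_max (\<lambda>v. R v - 1/2 * vnorm_sq ip v) (\<lambda>v. v \<in> vfields H) u"
    and "is_arg_max (\<lambda>v. R v - 1/2 * vnorm_sq ip v) (\<lambda>v. v \<in> vfields H) v \<Longrightarrow> v = u"
proof -
  let ?s = "grad_miss (\<lambda>x. ln (phat x))"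
  define L where "L b f = (LINT y|law q. f y * (?s y \<bullet> b) - lam * ip f (section_deriv y (b, 0)))" for b f
  note fin = finite_measure_law[OF q]
  have sets: "sets (law q) = sets borel"
    by simp
  have score_b: "integrable (law q) (\<lambda>y. ?s y \<bullet> b)" for b
    using score by simp
  note rep = stein_representer_mem[OF fin sets,
      where g = "\<lambda>y. ?s y \<bullet> b" and lam = lam and c = "(b, 0)" for b, OF score_b, folded L_def]
  have int: "integrable (law q) (\<lambda>y. f y * (?s y \<bullet> b))"
    "integrable (law q) (\<lambda>y. ip f (section_deriv y (b, 0)))" if "f \<in> H" for f b
    by (rule integrable_mult_mem[OF sets that score_b], rule integrable_ip_section_deriv[OF fin sets that])
  \<comment> \<open>The kernel gradient in the velocity acts on the second argument, so it
    differentiates \<open>rbf h x\<close> as a member of \<open>H\<close>. By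
    \<open>grad_miss_mem\<close> its components are pairings with \<open>section_deriv\<close>,
    exactly the form occurring in \<open>L\<close>.\<close>
  have u_eq: "u x \<bullet> b = L b (rbf h x)" if b: "b \<in> Basis" for x b
  proof -
    have comp: "(- lam *\<^sub>R grad_miss (rbf h x) y + rbf h x y *\<^sub>R ?s y) \<bullet> b'
        = rbf h x y * (?s y \<bullet> b') - lam * ip (rbf h x) (section_deriv y (b', 0))"
      if "b' \<in> Basis" for b' y
      by (simp add: inner_diff_left grad_miss_mem section_mem that)
    have "integrable (law q) (\<lambda>y. - lam *\<^sub>R grad_miss (rbf h x) y + rbf h x y *\<^sub>R ?s y)"
      by (rule integrable_componentwiseI)
        (simp only: comp, intro Bochner_Integration.integrable_diff integrable_mult_right int section_mem)
    from integral_inner_left[OF this, of b] show ?thesis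
      unfolding u_def joint_NER_velocity_def expect_def L_def comp[OF b] by simp
  qed
  have u: "u \<in> vfields H"
    using rep(1) by (simp add: vfields_def u_eq)
  have R: "R v = (\<Sum>b\<in>Basis. ip (\<lambda>x. v x \<bullet> b) (\<lambda>x. u x \<bullet> b))" if v: "v \<in> vfields H" for v
  proof -
    have vb: "(\<lambda>x. v x \<bullet> b) \<in> H" if "b \<in> Basis" for b
      using v that by (simp add: vfields_def)
    have "v x \<bullet> ?s x - lam * div_miss v x
        = (\<Sum>b\<in>Basis. (v x \<bullet> b) * (?s x \<bullet> b) - lam * ip (\<lambda>y. v y \<bullet> b) (section_deriv x (b, 0)))" for x
      unfolding div_miss_vfield[OF v] sum_distrib_left sum_subtractf
      by (subst euclidean_inner) (rule refl)
    then have "R v = (LINT x|law q. (\<Sum>b\<in>Basis. (v x \<bullet> b) * (?s x \<bullet> b)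
        - lam * ip (\<lambda>y. v y \<bullet> b) (section_deriv x (b, 0))))"
      unfolding R_def joint_NER_rate_def expect_def by (simp only:)
    also have "\<dots> = (\<Sum>b\<in>Basis. L b (\<lambda>x. v x \<bullet> b))"
      unfolding L_def by (rule Bochner_Integration.integral_sum) (use int vb in auto)
    also have "\<dots> = (\<Sum>b\<in>Basis. ip (\<lambda>x. v x \<bullet> b) (\<lambda>x. u x \<bullet> b))"
    proof (rule sum.cong)
      fix b :: 'm
      assume b: "b \<in> Basis"
      show "L b (\<lambda>x. v x \<bullet> b) = ip (\<lambda>x. v x \<bullet> b) (\<lambda>x. u x \<bullet> b)"
        unfolding u_eq[OF b] by (rule rep(2)[OF vb[OF b]])
    qed simp
    finally show ?thesis .
  qed
  show "is_arg_max (\<lambda>v. R v - 1/2 * vnorm_sq ip v) (\<lambda>v. v \<in> vfields H) u"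
    by (rule is_arg_max_regularised_linear(1)[OF u R])
  show "v = u" if "is_arg_max (\<lambda>v. R v - 1/2 * vnorm_sq ip v) (\<lambda>v. v \<in> vfields H) v"
    by (rule is_arg_max_regularised_linear(2)[OF u R that])
qed

end

section \<open>The rate along the continuity equation\<close>

text \<open>By the mean value theorem the bound on the time derivative dominates all difference
  quotients by \<open>G\<close>. The same increment bound carries integrability from
  \<open>\<tau>\<close> to nearby times, and dominated convergence along arbitrary sequences gives
  the limit.\<close>

lemma has_real_derivative_integral_dominated:
  fixes f :: "real \<Rightarrow> 'a \<Rightarrow> real"
  assumes \<epsilon>: "\<epsilon> > 0"
    and deriv: "\<And>t x. t \<in> {\<tau>-\<epsilon><..<\<tau>+\<epsilon>} \<Longrightarrow> ((\<lambda>s. f s x) has_real_derivative f' t x) (at t)"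
    and bound: "\<And>t x. t \<in> {\<tau>-\<epsilon><..<\<tau>+\<epsilon>} \<Longrightarrow> \<bar>f' t x\<bar> \<le> G x"
    and G: "integrable M G"
    and meas: "\<And>t. t \<in> {\<tau>-\<epsilon><..<\<tau>+\<epsilon>} \<Longrightarrow> f t \<in> borel_measurable M"
    and int: "integrable M (f \<tau>)"
  shows "integrable M (f' \<tau>)"
    and "t \<in> {\<tau>-\<epsilon><..<\<tau>+\<epsilon>} \<Longrightarrow> integrable M (f t)"
    and "((\<lambda>t. integral\<^sup>L M (f t)) has_real_derivative integral\<^sup>L M (f' \<tau>)) (at \<tau>)"
proof -
  let ?T = "{\<tau>-\<epsilon><..<\<tau>+\<epsilon>}"
  have \<tau>: "\<tau> \<in> ?T"
    using \<epsilon> by simp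
  have at_T: "at \<tau> within ?T = at \<tau>"
    by (rule at_within_open[OF \<tau>]) simp
  have mvt: "\<bar>f t x - f \<tau> x\<bar> \<le> G x * \<bar>t - \<tau>\<bar>" if "t \<in> ?T" for t x
    unfolding real_norm_def[symmetric]
    by (rule field_differentiable_bound[of ?T "\<lambda>s. f s x" "\<lambda>s. f' s x"])
      (auto intro!: convex_real_interval DERIV_subset[OF deriv] simp: bound \<epsilon> that[simplified])
  show int_t: "integrable M (f t)" if t: "t \<in> ?T" for t
  proof -
    have "integrable M (\<lambda>x. f t x - f \<tau> x)"
    proof (rule Bochner_Integration.integrable_bound)
      show "integrable M (\<lambda>x. G x * \<bar>t - \<tau>\<bar>)"
        using G by simp
      show "(\<lambda>x. f t x - f \<tau> x) \<in> borel_measurable M"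
        using meas[OF t] meas[OF \<tau>] by simp
      show "AE x in M. norm (f t x - f \<tau> x) \<le> norm (G x * \<bar>t - \<tau>\<bar>)"
        using mvt[OF t] by (intro AE_I2) (simp add: order.trans[OF _ abs_ge_self])
    qed
    from Bochner_Integration.integrable_add[OF this int] show ?thesis
      by simp
  qed
  have quot: "(\<lambda>n. (f (X n) x - f \<tau> x) / (X n - \<tau>)) \<longlonglongrightarrow> f' \<tau> x"
    if "\<And>n. X n \<in> ?T - {\<tau>}" "X \<longlonglongrightarrow> \<tau>" for X x
  proof -
    have "((\<lambda>t. (f t x - f \<tau> x) / (t - \<tau>)) \<longlongrightarrow> f' \<tau> x) (at \<tau> within ?T)"
      using deriv[OF \<tau>, of x] unfolding at_T by (simp add: has_field_derivative_iff)
    then show ?thesis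
      using that unfolding tendsto_at_iff_sequentially comp_def by blast
  qed
  have quot_meas: "(\<lambda>x. (f (X n) x - f \<tau> x) / (X n - \<tau>)) \<in> borel_measurable M"
    if "\<And>n. X n \<in> ?T - {\<tau>}" for X :: "nat \<Rightarrow> real" and n
    using meas[of "X n"] meas[OF \<tau>] that[of n] by simp
  \<comment> \<open>A concrete sequence exhibiting \<open>f' \<tau>\<close> as a limit of measurable
    quotients. The offset 2 keeps \<open>X0 0\<close> strictly inside the open interval; offset 1
    would hit its endpoint.\<close>
  define X0 where "X0 n = \<tau> + \<epsilon> / real (n + 2)" for n
  have X0: "X0 n \<in> ?T - {\<tau>}" for n
    using \<epsilon> by (simp add: X0_def field_simps add_nonneg_pos add_pos_nonneg)
  have "(\<lambda>n. \<epsilon> / real (n + 2)) \<longlonglongrightarrow> 0"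
    by (rule LIMSEQ_ignore_initial_segment[OF lim_const_over_n])
  from tendsto_add[OF tendsto_const this, of \<tau>] have X0_lim: "X0 \<longlonglongrightarrow> \<tau>"
    unfolding X0_def by simp
  have meas': "f' \<tau> \<in> borel_measurable M"
    by (rule borel_measurable_LIMSEQ_real) (rule quot[OF X0 X0_lim], rule quot_meas[OF X0])
  show "integrable M (f' \<tau>)"
    by (rule Bochner_Integration.integrable_bound[OF G meas'])
      (intro AE_I2, simp add: order.trans[OF bound[OF \<tau>] abs_ge_self])
  have "((\<lambda>t. (integral\<^sup>L M (f t) - integral\<^sup>L M (f \<tau>)) / (t - \<tau>)) \<longlongrightarrow> integral\<^sup>L M (f' \<tau>)) (at \<tau> within ?T)"
    unfolding tendsto_at_iff_sequentially comp_def
  proof (intro allI impI)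
    fix X
    assume "\<forall>i. X i \<in> ?T - {\<tau>}" and lim: "X \<longlonglongrightarrow> \<tau>"
    then have X: "X i \<in> ?T - {\<tau>}" for i
      by blast
    have "(\<lambda>n. LINT x|M. (f (X n) x - f \<tau> x) / (X n - \<tau>)) \<longlonglongrightarrow> integral\<^sup>L M (f' \<tau>)"
    proof (rule integral_dominated_convergence[where w = G, OF meas' _ G])
      show "(\<lambda>x. (f (X n) x - f \<tau> x) / (X n - \<tau>)) \<in> borel_measurable M" for n
        by (rule quot_meas[OF X])
      show "AE x in M. (\<lambda>n. (f (X n) x - f \<tau> x) / (X n - \<tau>)) \<longlonglongrightarrow> f' \<tau> x"
        using quot[OF X lim] by simp
      show "AE x in M. norm ((f (X n) x - f \<tau> x) / (X n - \<tau>)) \<le> G x" for n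
        using mvt[of "X n"] X[of n] by (intro AE_I2) (simp add: divide_le_eq)
    qed
    moreover have "(LINT x|M. (f (X n) x - f \<tau> x) / (X n - \<tau>))
        = (integral\<^sup>L M (f (X n)) - integral\<^sup>L M (f \<tau>)) / (X n - \<tau>)" for n
      using int_t[of "X n"] X[of n] int by simp
    ultimately show "(\<lambda>n. (integral\<^sup>L M (f (X n)) - integral\<^sup>L M (f \<tau>)) / (X n - \<tau>)) \<longlonglongrightarrow> integral\<^sup>L M (f' \<tau>)"
      by (simp only:)
  qed
  then show "((\<lambda>t. integral\<^sup>L M (f t)) has_real_derivative integral\<^sup>L M (f' \<tau>)) (at \<tau>)"
    unfolding at_T by (simp add: has_field_derivative_iff)
qed

section \<open>Calculus and integration by parts in the missing coordinates\<close>

lemma differentiable_missD: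
  "differentiable_miss f \<Longrightarrow> (\<lambda>z. f (z, snd x)) differentiable (at (fst x))"
  by (simp add: differentiable_miss_def)

lemma has_derivative_along_miss:
  assumes "(\<lambda>z. f (z, snd x)) differentiable (at (fst x))" "b \<in> Basis"
  shows "((\<lambda>s. f (x + s *\<^sub>R (b, 0))) has_real_derivative grad_miss f x \<bullet> b) (at 0)"
proof -
  obtain D where D: "((\<lambda>z. f (z, snd x)) has_derivative D) (at (fst x))"
    using assms by (auto simp: differentiable_def)
  have "((\<lambda>s. fst x + s *\<^sub>R b) has_derivative (\<lambda>s. s *\<^sub>R b)) (at 0)"
    by (auto intro!: derivative_eq_intros)
  from has_derivative_compose[OF this, of "\<lambda>z. f (z, snd x)" D]
  have "((\<lambda>s. f (fst x + s *\<^sub>R b, snd x)) has_derivative (\<lambda>s. D (s *\<^sub>R b))) (at 0)"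
    using D by simp
  moreover have "D (s *\<^sub>R b) = D b * s" for s
    using linear_cmul[OF has_derivative_linear[OF D]] by simp
  moreover have "(fst x + s *\<^sub>R b, snd x) = x + s *\<^sub>R (b, 0)" for s
    by (simp add: prod_eq_iff)
  ultimately show ?thesis
    by (simp add: has_field_derivative_def grad_miss_inner_eq[OF D assms(2)])
qed

lemma grad_miss_mult:
  assumes "(\<lambda>z. f (z, snd x)) differentiable (at (fst x))"
    and "(\<lambda>z. g (z, snd x)) differentiable (at (fst x))" and b: "b \<in> Basis"
  shows "grad_miss (\<lambda>y. f y * g y) x \<bullet> b = (grad_miss f x \<bullet> b) * g x + f x * (grad_miss g x \<bullet> b)"
proof -
  obtain D E where D: "((\<lambda>z. f (z, snd x)) has_derivative D) (at (fst x))"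
    and E: "((\<lambda>z. g (z, snd x)) has_derivative E) (at (fst x))"
    using assms by (auto simp: differentiable_def)
  show ?thesis
    unfolding grad_miss_inner_eq[OF D b] grad_miss_inner_eq[OF E b]
      grad_miss_inner_eq[where f = "\<lambda>y. f y * g y", OF has_derivative_mult[OF D E] b]
    by simp
qed

lemma
  assumes "(\<lambda>z. f (z, snd x)) differentiable (at (fst x))" and "f x > 0"
  shows differentiable_ln_miss: "(\<lambda>z. ln (f (z, snd x))) differentiable (at (fst x))"
    and grad_miss_ln:
      "b \<in> Basis \<Longrightarrow> grad_miss (\<lambda>y. ln (f y)) x \<bullet> b = (grad_miss f x \<bullet> b) / f x"
proof -
  obtain D where D: "((\<lambda>z. f (z, snd x)) has_derivative D) (at (fst x))"
    using assms(1) by (auto simp: differentiable_def)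
  have ln: "((\<lambda>z. ln (f (z, snd x))) has_derivative (\<lambda>a. D a * inverse (f x))) (at (fst x))"
    using has_derivative_ln[OF _ D] assms(2) by simp
  then show "(\<lambda>z. ln (f (z, snd x))) differentiable (at (fst x))"
    by (auto simp: differentiable_def)
  show "grad_miss (\<lambda>y. ln (f y)) x \<bullet> b = (grad_miss f x \<bullet> b) / f x" if b: "b \<in> Basis"
    unfolding grad_miss_inner_eq[OF D b] grad_miss_inner_eq[where f = "\<lambda>y. ln (f y)", OF ln b]
    by (simp add: divide_inverse)
qed

lemma div_miss_scaleR:
  assumes "(\<lambda>z. f (z, snd x)) differentiable (at (fst x))"
    and "(\<lambda>z. v (z, snd x)) differentiable (at (fst x))"
  shows "div_miss (\<lambda>y. f y *\<^sub>R v y) x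
    = (\<Sum>b\<in>Basis. (grad_miss f x \<bullet> b) * (v x \<bullet> b) + f x * (grad_miss (\<lambda>y. v y \<bullet> b) x \<bullet> b))"
proof -
  have "(\<lambda>z. v (z, snd x) \<bullet> b) differentiable (at (fst x))" for b
    using assms(2) by (auto simp: differentiable_def intro: has_derivative_inner_left)
  note grad = grad_miss_mult[where g = "\<lambda>y. v y \<bullet> b" for b, OF assms(1) this]
  have "(\<lambda>z. f (z, snd x) *\<^sub>R v (z, snd x)) differentiable (at (fst x))"
    using assms by (intro differentiable_scaleR)
  from div_miss_eq_sum_grad_miss[where v = "\<lambda>y. f y *\<^sub>R v y", OF this]
  show ?thesis
    by (simp add: grad)
qed

text \<open>Integrating by parts against \<open>g = ln phat + lam ln q\<close> removes the logarithms: the difference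
  of the two sides is the integral of the divergence of \<open>q g v\<close> in the missing coordinates.\<close>

lemma (in gaussian_rkhs_pair) joint_NER_rate_by_parts:
  fixes phat q :: "'m \<times> 'o \<Rightarrow> real" and lam :: real and v :: "'m \<times> 'o \<Rightarrow> 'm"
  defines "g \<equiv> \<lambda>x. ln (phat x) + lam * ln (q x)"
    and "A \<equiv> \<lambda>x. 1 + \<bar>ln (q x)\<bar> + \<bar>ln (phat x)\<bar>"
  assumes phat: "phat \<in> borel_measurable borel" "\<And>x. phat x > 0" "differentiable_miss phat"
    and q: "prob_density q" "\<And>x. q x > 0" "differentiable_miss q"
    and v: "v \<in> vfields H"
    and int_g: "integrable lborel (\<lambda>x. q x * g x)"
    and int_score: "integrable lborel (\<lambda>x. q x *\<^sub>R grad_miss (\<lambda>y. ln (phat y)) x)"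
    and int_grad: "integrable lborel (\<lambda>x. A x *\<^sub>R grad_miss q x)"
    and int_div: "integrable lborel (\<lambda>x. div_miss (\<lambda>y. q y *\<^sub>R v y) x * (g x + lam))"
  shows "joint_NER_rate phat lam q v = - (LINT x|lborel. div_miss (\<lambda>y. q y *\<^sub>R v y) x * (g x + lam))"
proof -
  let ?s = "grad_miss (\<lambda>y. ln (phat y))"
  have [measurable]: "phat \<in> borel_measurable borel" "q \<in> borel_measurable borel"
    using phat(1) prob_density_measurable[OF q(1)] .
  have [measurable]: "g \<in> borel_measurable borel" "A \<in> borel_measurable borel"
    unfolding g_def A_def by measurable
  have A: "A x \<ge> 1" for x
    by (simp add: A_def)
  have g_le: "\<bar>g x\<bar> \<le> (1 + \<bar>lam\<bar>) * A x" for x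
  proof -
    have "\<bar>g x\<bar> \<le> \<bar>ln (phat x)\<bar> + \<bar>lam\<bar> * \<bar>ln (q x)\<bar>"
      unfolding g_def abs_mult[symmetric] by (rule abs_triangle_ineq)
    also have "\<dots> \<le> (1 + \<bar>lam\<bar>) * A x"
      by (simp add: A_def algebra_simps add_increasing add_increasing2)
    finally show ?thesis .
  qed
  have vb: "(\<lambda>x. v x \<bullet> b) \<in> H" if "b \<in> Basis" for b
    using v that by (simp add: vfields_def)
  define dq where "dq b x = grad_miss q x \<bullet> b" for b x
  define dv where "dv b x = grad_miss (\<lambda>y. v y \<bullet> b) x \<bullet> b" for b x
  have dv_eq: "dv b x = ip (\<lambda>x. v x \<bullet> b) (section_deriv x (b, 0))" if "b \<in> Basis" for b x
    unfolding dv_def by (rule grad_miss_mem[OF vb[OF that] that])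
  \<comment> \<open>\<open>W b\<close> is the component of \<open>q g v\<close> along
    \<open>b\<close>, and \<open>W' b\<close> its derivative in that direction, where the factor
    \<open>q\<close> cancels the \<open>1 / q\<close> of the gradient of \<open>ln q\<close>. The
    four summands of \<open>W'\<close> are kept apart because each is integrable by itself: a
    bounded factor from the space times an integrable function.\<close>
  define W where "W b x = q x * g x * (v x \<bullet> b)" for b x
  define W' where "W' b x = (v x \<bullet> b) * (g x * dq b x) + dv b x * (q x * g x)
      + (v x \<bullet> b) * (q x * (?s x \<bullet> b)) + lam * ((v x \<bullet> b) * dq b x)" for b x
  note diff_q = differentiable_missD[OF q(3)]
  have diff_g: "(\<lambda>z. g (z, snd x)) differentiable (at (fst x))" for x
    unfolding g_def
    by (intro differentiable_add differentiable_mult differentiable_const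
        differentiable_ln_miss[OF diff_q q(2)]
        differentiable_ln_miss[OF differentiable_missD[OF phat(3)] phat(2)])
  have grad_g: "grad_miss g x \<bullet> b = ?s x \<bullet> b + lam * (dq b x / q x)" if b: "b \<in> Basis" for b x
  proof -
    obtain D where D: "((\<lambda>z. ln (phat (z, snd x))) has_derivative D) (at (fst x))"
      using differentiable_ln_miss[of phat x, OF differentiable_missD[OF phat(3)] phat(2)]
      unfolding differentiable_def by blast
    obtain E where E: "((\<lambda>z. ln (q (z, snd x))) has_derivative E) (at (fst x))"
      using differentiable_ln_miss[of q x, OF diff_q q(2)] unfolding differentiable_def by blast
    have "grad_miss g x \<bullet> b = D b + lam * E b"
      unfolding g_def
      by (rule grad_miss_inner_eq[where f = "\<lambda>x. ln (phat x) + lam * ln (q x)",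
            OF has_derivative_add[OF D has_derivative_mult_right[OF E]] b])
    then show ?thesis
      unfolding grad_miss_inner_eq[where f = "\<lambda>y. ln (phat y)", OF D b, symmetric]
        grad_miss_inner_eq[where f = "\<lambda>y. ln (q y)", OF E b, symmetric] dq_def
        grad_miss_ln[OF diff_q q(2) b] .
  qed
  have int_dq: "integrable lborel (\<lambda>x. A x * dq b x)" for b
    using integrable_inner_left[OF int_grad, of b] by (simp add: dq_def)
  \<comment> \<open>The hypothesis on the weighted gradient passes to any coefficient dominated by
    the weight \<open>A\<close>: the ratio of the two is bounded.\<close>
  have int_mult_dq: "integrable lborel (\<lambda>x. c x * dq b x)"
    if [measurable]: "c \<in> borel_measurable borel" and c: "\<And>x. \<bar>c x\<bar> \<le> C * A x" for b C c
  proof -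
    have "integrable lborel (\<lambda>x. c x / A x * (A x * dq b x))"
    proof (rule integrable_bounded_mult[OF _ _ int_dq])
      show "\<bar>c x / A x\<bar> \<le> C" for x
        using c[of x] A[of x] by (simp add: divide_le_eq)
    qed measurable
    moreover have "c x / A x * (A x * dq b x) = c x * dq b x" for x
      using A[of x] by simp
    ultimately show ?thesis
      by simp
  qed
  have W_int: "integrable lborel (W b)" if b: "b \<in> Basis" for b
    using integrable_mult_mem[OF sets_lborel vb[OF b] int_g] by (simp add: W_def[abs_def] mult_ac)
  have W'_int: "integrable lborel (W' b)" if b: "b \<in> Basis" for b
  proof -
    have 1: "integrable lborel (\<lambda>x. g x * dq b x)"
      by (rule int_mult_dq[OF _ g_le]) measurable
    have "integrable lborel (\<lambda>x. 1 * dq b x)"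
      using A by (intro int_mult_dq[of _ 1]) auto
    then have 2: "integrable lborel (dq b)"
      by simp
    have 3: "integrable lborel (\<lambda>x. q x * (?s x \<bullet> b))"
      using integrable_inner_left[OF int_score, of b] by simp
    have 4: "integrable lborel (\<lambda>x. dv b x * (q x * g x))"
      unfolding dv_eq[OF b]
      by (rule integrable_bounded_mult[OF _ abs_ip_section_deriv_le[OF vb[OF b]] int_g])
        (use borel_measurable_ip_section_deriv[OF vb[OF b]] in simp)
    note m = integrable_mult_mem[OF sets_lborel vb[OF b]]
    show ?thesis
      unfolding W'_def
      by (intro Bochner_Integration.integrable_add integrable_mult_right m 1 2 3 4)
  qed
  have W_deriv: "((\<lambda>s. W b (x + s *\<^sub>R (b, 0))) has_real_derivative W' b x) (at 0)" if b: "b \<in> Basis" for b x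
  proof -
    have "((\<lambda>s. q (x + s *\<^sub>R (b, 0)) * g (x + s *\<^sub>R (b, 0)) * (v (x + s *\<^sub>R (b, 0)) \<bullet> b))
        has_real_derivative
          (dq b x * g (x + 0 *\<^sub>R (b, 0)) + (?s x \<bullet> b + lam * (dq b x / q x)) * q (x + 0 *\<^sub>R (b, 0)))
            * (v (x + 0 *\<^sub>R (b, 0)) \<bullet> b)
          + dv b x * (q (x + 0 *\<^sub>R (b, 0)) * g (x + 0 *\<^sub>R (b, 0)))) (at 0)"
      using has_derivative_along_miss[OF diff_q b] has_derivative_along_miss[where f = g, OF diff_g b]
        has_derivative_along_mem[OF vb[OF b], of x "(b, 0)"]
      by (intro DERIV_mult) (simp_all only: dq_def grad_g[OF b] dv_eq[OF b])
    then show ?thesis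
      unfolding W_def
      by (rule DERIV_cong) (use q(2)[of x] in \<open>simp add: W'_def field_simps flip: zero_prod_def\<close>)
  qed
  have W'_0: "integral\<^sup>L lborel (W' b) = 0" if b: "b \<in> Basis" for b
    by (rule integral_directional_derivative_eq_0[OF W_int[OF b] W'_int[OF b] W_deriv[OF b]])
  \<comment> \<open>The extra \<open>lam\<close> beside \<open>g\<close> cancels the term
    \<open>lam * ((v x \<bullet> b) * dq b x)\<close> of \<open>W'\<close> and leaves
    \<open>- lam * q x * div_miss v x\<close>, so all logarithms disappear.\<close>
  have pointwise: "q x * (v x \<bullet> ?s x - lam * div_miss v x)
      = (\<Sum>b\<in>Basis. W' b x) - div_miss (\<lambda>y. q y *\<^sub>R v y) x * (g x + lam)" for x
  proof -
    have dv: "div_miss v x = (\<Sum>b\<in>Basis. dv b x)"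
      unfolding dv_def by (rule div_miss_eq_sum_grad_miss[OF differentiable_vfield[OF v]])
    have vs: "v x \<bullet> ?s x = (\<Sum>b\<in>Basis. (v x \<bullet> b) * (?s x \<bullet> b))"
      by (rule euclidean_inner)
    have "div_miss (\<lambda>y. q y *\<^sub>R v y) x = (\<Sum>b\<in>Basis. dq b x * (v x \<bullet> b) + q x * dv b x)"
      unfolding dq_def dv_def by (rule div_miss_scaleR[OF diff_q differentiable_vfield[OF v]])
    then show ?thesis
      unfolding dv vs
      by (simp add: sum_distrib_left sum_distrib_right sum_subtractf[symmetric] W'_def algebra_simps)
  qed
  \<comment> \<open>Writing the integrand of the rate as \<open>r x / q x\<close> reduces its
    measurability to that of \<open>r\<close> and \<open>q\<close>.\<close>
  define r where "r x = (\<Sum>b\<in>Basis. W' b x) - div_miss (\<lambda>y. q y *\<^sub>R v y) x * (g x + lam)" for x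
  have sum_int: "integrable lborel (\<lambda>x. \<Sum>b\<in>Basis. W' b x)"
    by (intro Bochner_Integration.integrable_sum W'_int)
  have "integrable lborel r"
    unfolding r_def by (intro Bochner_Integration.integrable_diff sum_int int_div)
  then have [measurable]: "r \<in> borel_measurable borel"
    by (auto dest: borel_measurable_integrable)
  have "v x \<bullet> ?s x - lam * div_miss v x = r x / q x" for x
    using pointwise[of x] q(2)[of x] unfolding r_def[symmetric] by (simp add: field_simps)
  then have "joint_NER_rate phat lam q v = (LINT x|law q. r x / q x)"
    by (simp only: joint_NER_rate_def expect_def)
  also have "\<dots> = (LINT x|lborel. q x *\<^sub>R (r x / q x))"
    by (intro integral_density AE_I2 less_imp_le q(2)) measurable
  also have "\<dots> = integral\<^sup>L lborel r"
    using q(2) by (simp add: less_imp_neq[THEN not_sym])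
  also have "\<dots> = (LINT x|lborel. (\<Sum>b\<in>Basis. W' b x))
      - (LINT x|lborel. div_miss (\<lambda>y. q y *\<^sub>R v y) x * (g x + lam))"
    unfolding r_def by (rule Bochner_Integration.integral_diff[OF sum_int int_div])
  also have "(LINT x|lborel. (\<Sum>b\<in>Basis. W' b x)) = 0"
    by (subst Bochner_Integration.integral_sum) (simp_all add: W'_int W'_0)
  finally show ?thesis
    by simp
qed

section \<open>The derivative of the joint cost along a regular evolution\<close>

lemma expect_eq_lborel:
  fixes f :: "'a::euclidean_space \<Rightarrow> real"
  assumes "prob_density q" "f \<in> borel_measurable borel"
  shows "expect q f = (LINT x|lborel. q x * f x)"
  using assms prob_density_measurable[OF assms(1)] unfolding expect_def
  by (subst integral_density) (auto simp: prob_density_def)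

lemma F_joint_NER_eq_lborel:
  assumes "prob_density q" and [measurable]: "phat \<in> borel_measurable borel"
  shows "F_joint_NER phat lam q
    = (LINT x|lborel. q x * ln (phat x)) + lam * (LINT x|lborel. q x * ln (q x))"
  unfolding F_joint_NER_def diff_entropy_def by (subst expect_eq_lborel[OF assms(1)]) simp_all

text \<open>One dominating function serves both parts of the cost: the weight in
  \<open>regular_evolution\<close> covers the factor \<open>ln phat\<close> of the likelihood and
  the factor \<open>ln \<rho> + 1\<close> of the entropy. Integration by parts takes place at time
  \<open>\<tau>\<close> only, where the velocity is known to lie in
  \<open>vfields H\<close>.\<close>

lemma (in gaussian_rkhs_pair) has_rate_joint_NER:
  fixes phat q :: "'m \<times> 'o \<Rightarrow> real" and v :: "'m \<times> 'o \<Rightarrow> 'm"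
  assumes phat: "prob_density phat" "\<And>x. phat x > 0" "differentiable_miss phat"
    and v: "v \<in> vfields H"
  shows "has_rate phat (F_joint_NER phat lam) q \<tau> v (joint_NER_rate phat lam q v)"
  unfolding has_rate_def
proof (intro allI impI, elim conjE)
  fix \<rho>
  assume reg: "regular_evolution phat \<tau> v \<rho>" and q: "\<rho> \<tau> = q"
  note [measurable] = prob_density_measurable[OF phat(1)]
  from reg obtain \<epsilon> w G where \<epsilon>: "\<epsilon> > 0" and w: "w \<tau> = v"
    and ce: "continuity_equation {\<tau> - \<epsilon><..<\<tau> + \<epsilon>} w \<rho>"
    and \<rho>: "\<And>t. t \<in> {\<tau> - \<epsilon><..<\<tau> + \<epsilon>} \<Longrightarrow> prob_density (\<rho> t)"
    and \<rho>_pos: "\<And>t x. t \<in> {\<tau> - \<epsilon><..<\<tau> + \<epsilon>} \<Longrightarrow> 0 < \<rho> t x"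
    and G: "integrable lborel G"
    and dom: "\<And>t x. t \<in> {\<tau> - \<epsilon><..<\<tau> + \<epsilon>} \<Longrightarrow>
      \<bar>div_miss (\<lambda>y. \<rho> t y *\<^sub>R w t y) x\<bar> * (1 + \<bar>ln (\<rho> t x)\<bar> + \<bar>ln (phat x)\<bar>) \<le> G x"
    unfolding regular_evolution_def by blast
  have diff_q: "differentiable_miss q" and ent: "integrable lborel (\<lambda>x. q x * ln (q x))"
    and int_phat: "integrable lborel (\<lambda>x. q x * ln (phat x))"
    and score: "integrable lborel (\<lambda>x. q x *\<^sub>R grad_miss (\<lambda>y. ln (phat y)) x)"
    and grad: "integrable lborel (\<lambda>x. (1 + \<bar>ln (q x)\<bar> + \<bar>ln (phat x)\<bar>) *\<^sub>R grad_miss q x)"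
    using reg q by (simp_all add: regular_evolution_def finite_entropy_def)
  let ?T = "{\<tau> - \<epsilon><..<\<tau> + \<epsilon>}"
  have \<tau>: "\<tau> \<in> ?T"
    using \<epsilon> by simp
  define d where "d t x = div_miss (\<lambda>y. \<rho> t y *\<^sub>R w t y) x" for t x
  have \<rho>_deriv: "((\<lambda>s. \<rho> s x) has_real_derivative - d t x) (at t)" if "t \<in> ?T" for t x
    using ce that unfolding continuity_equation_def d_def by blast
  have d_bound: "\<bar>d t x\<bar> * a \<le> G x" if "t \<in> ?T" "a \<le> 1 + \<bar>ln (\<rho> t x)\<bar> + \<bar>ln (phat x)\<bar>" for t x a
    using mult_left_mono[OF that(2) abs_ge_zero[of "d t x"]] dom[OF that(1), of x]
    unfolding d_def by (rule order.trans)
  note \<rho>_meas = prob_density_measurable[OF \<rho>]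
  note lik = has_real_derivative_integral_dominated[where M = lborel and G = G and \<tau> = \<tau>
      and f = "\<lambda>t x. \<rho> t x * ln (phat x)" and f' = "\<lambda>t x. - d t x * ln (phat x)", OF \<epsilon>]
  note neg_ent = has_real_derivative_integral_dominated[where M = lborel and G = G and \<tau> = \<tau>
      and f = "\<lambda>t x. \<rho> t x * ln (\<rho> t x)" and f' = "\<lambda>t x. - d t x * (ln (\<rho> t x) + 1)", OF \<epsilon>]
  have lik_deriv: "((\<lambda>s. \<rho> s x * ln (phat x)) has_real_derivative - d t x * ln (phat x)) (at t)"
    if "t \<in> ?T" for t x
    by (rule DERIV_cmult_right[OF \<rho>_deriv[OF that]])
  have lik_bound: "\<bar>- d t x * ln (phat x)\<bar> \<le> G x" if "t \<in> ?T" for t x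
    using d_bound[OF that, of "\<bar>ln (phat x)\<bar>" x] by (simp add: abs_mult)
  have lik_meas: "(\<lambda>x. \<rho> t x * ln (phat x)) \<in> borel_measurable lborel" if "t \<in> ?T" for t
    using \<rho>_meas[OF that] by measurable
  have ent_deriv: "((\<lambda>s. \<rho> s x * ln (\<rho> s x)) has_real_derivative - d t x * (ln (\<rho> t x) + 1)) (at t)"
    if "t \<in> ?T" for t x
    by (rule DERIV_cong[OF DERIV_mult[OF \<rho>_deriv[OF that]
            DERIV_chain2[OF DERIV_ln_divide[OF \<rho>_pos[OF that]] \<rho>_deriv[OF that]]]])
      (use \<rho>_pos[OF that, of x] in \<open>simp add: algebra_simps\<close>)
  have ent_bound: "\<bar>- d t x * (ln (\<rho> t x) + 1)\<bar> \<le> G x" if "t \<in> ?T" for t x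
    using d_bound[OF that, of "\<bar>ln (\<rho> t x) + 1\<bar>" x] by (simp add: abs_mult)
  have ent_meas: "(\<lambda>x. \<rho> t x * ln (\<rho> t x)) \<in> borel_measurable lborel" if "t \<in> ?T" for t
    using \<rho>_meas[OF that] by measurable
  note lik = lik[OF lik_deriv lik_bound G lik_meas int_phat[folded q]]
  note neg_ent = neg_ent[OF ent_deriv ent_bound G ent_meas ent[folded q]]
  have "((\<lambda>t. (LINT x|lborel. \<rho> t x * ln (phat x)) + lam * (LINT x|lborel. \<rho> t x * ln (\<rho> t x)))
      has_real_derivative (LINT x|lborel. - d \<tau> x * ln (phat x))
        + lam * (LINT x|lborel. - d \<tau> x * (ln (\<rho> \<tau> x) + 1))) (at \<tau>)"
    by (intro DERIV_add DERIV_cmult lik(3) neg_ent(3))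
  moreover have "(LINT x|lborel. - d \<tau> x * ln (phat x))
        + lam * (LINT x|lborel. - d \<tau> x * (ln (\<rho> \<tau> x) + 1)) = joint_NER_rate phat lam q v"
  proof -
    \<comment> \<open>The isolated \<open>lam\<close> comes from the 1 in the derivative
      \<open>ln \<rho> + 1\<close> of \<open>\<rho> * ln \<rho>\<close>.\<close>
    have eq: "- (- d \<tau> x * ln (phat x) + lam * (- d \<tau> x * (ln (\<rho> \<tau> x) + 1)))
        = div_miss (\<lambda>y. q y *\<^sub>R v y) x * (ln (phat x) + lam * ln (q x) + lam)" for x
      unfolding d_def w q by (simp add: algebra_simps)
    have int: "integrable lborel (\<lambda>x. - d \<tau> x * ln (phat x) + lam * (- d \<tau> x * (ln (\<rho> \<tau> x) + 1)))"
      by (intro Bochner_Integration.integrable_add integrable_mult_right lik(1) neg_ent(1))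
    have int_div: "integrable lborel (\<lambda>x. div_miss (\<lambda>y. q y *\<^sub>R v y) x * (ln (phat x) + lam * ln (q x) + lam))"
      using integrable_minus[OF int] unfolding eq .
    have int_g: "integrable lborel (\<lambda>x. q x * (ln (phat x) + lam * ln (q x)))"
      using Bochner_Integration.integrable_add[OF int_phat integrable_mult_right[OF ent, of lam]]
      by (simp add: algebra_simps)
    have "joint_NER_rate phat lam q v
        = - (LINT x|lborel. div_miss (\<lambda>y. q y *\<^sub>R v y) x * (ln (phat x) + lam * ln (q x) + lam))"
      using \<rho>[OF \<tau>] \<rho>_pos[OF \<tau>] unfolding q
      by (intro joint_NER_rate_by_parts phat diff_q v int_g score grad int_div) simp_all
    also have "\<dots> = (LINT x|lborel. - d \<tau> x * ln (phat x) + lam * (- d \<tau> x * (ln (\<rho> \<tau> x) + 1)))"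
      unfolding eq[symmetric] by (simp only: Bochner_Integration.integral_minus minus_minus)
    also have "\<dots> = (LINT x|lborel. - d \<tau> x * ln (phat x))
        + lam * (LINT x|lborel. - d \<tau> x * (ln (\<rho> \<tau> x) + 1))"
    proof (subst Bochner_Integration.integral_add)
      show "integrable lborel (\<lambda>x. - d \<tau> x * ln (phat x))"
        by (rule lik(1))
      show "integrable lborel (\<lambda>x. lam * (- d \<tau> x * (ln (\<rho> \<tau> x) + 1)))"
        by (intro integrable_mult_right neg_ent(1))
    qed (simp only: integral_mult_right_zero)
    finally show ?thesis
      by (rule sym)
  qed
  ultimately have deriv: "((\<lambda>t. (LINT x|lborel. \<rho> t x * ln (phat x))
      + lam * (LINT x|lborel. \<rho> t x * ln (\<rho> t x))) has_real_derivative joint_NER_rate phat lam q v) (at \<tau>)"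
    by (simp only:)
  \<comment> \<open>The cost has its Lebesgue form only at times where \<open>\<rho> t\<close> is
    known to be a density, so the derivative is transferred on the open interval.\<close>
  show "((\<lambda>t. F_joint_NER phat lam (\<rho> t)) has_real_derivative joint_NER_rate phat lam q v) (at \<tau>)"
  proof (rule has_field_derivative_transform_within_open[OF deriv _ \<tau>])
    show "(LINT x|lborel. \<rho> t x * ln (phat x)) + lam * (LINT x|lborel. \<rho> t x * ln (\<rho> t x))
        = F_joint_NER phat lam (\<rho> t)" if "t \<in> ?T" for t
      by (rule F_joint_NER_eq_lborel[symmetric, OF \<rho>[OF that]]) measurable
  qed simp
qed

section \<open>The gap between the functionals\<close>

lemma
  fixes f :: "'m::euclidean_space \<Rightarrow> real" and g :: "'o::euclidean_space \<Rightarrow> real"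
  assumes f: "integrable lborel f" and g: "integrable lborel g"
  shows integrable_lborel_prod_mult: "integrable lborel (\<lambda>x. f (fst x) * g (snd x))"
    and integral_lborel_prod_mult:
      "(LINT x|lborel. f (fst x) * g (snd x)) = integral\<^sup>L lborel f * integral\<^sup>L lborel g"
proof -
  have [measurable]: "f \<in> borel_measurable borel" "g \<in> borel_measurable borel"
    using f g by (auto dest: borel_measurable_integrable)
  have int: "integrable (lborel \<Otimes>\<^sub>M lborel) (\<lambda>x. f (fst x) * g (snd x))"
  proof (rule lborel_pair.Fubini_integrable)
    show "(\<lambda>x. f (fst x) * g (snd x)) \<in> borel_measurable (lborel \<Otimes>\<^sub>M lborel)"
      by measurable
    show "integrable lborel (\<lambda>x. LINT y|lborel. norm (f (fst (x, y)) * g (snd (x, y))))"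
      using f by (simp add: abs_mult)
    show "AE x in lborel. integrable lborel (\<lambda>y. f (fst (x, y)) * g (snd (x, y)))"
      using g by simp
  qed
  then show "integrable lborel (\<lambda>x. f (fst x) * g (snd x))"
    by (simp only: lborel_prod)
  show "(LINT x|lborel. f (fst x) * g (snd x)) = integral\<^sup>L lborel f * integral\<^sup>L lborel g"
    using lborel_pair.integral_fst'[OF int] by (simp add: lborel_prod)
qed

lemma prob_density_joint:
  assumes "prob_density r" "prob_density p"
  shows "prob_density (joint r p)"
  using assms integrable_lborel_prod_mult[of r p] integral_lborel_prod_mult[of r p]
  by (simp add: prob_density_def joint_def[abs_def])

lemma diff_entropy_joint:
  assumes r: "prob_density r" "finite_entropy r" and p: "prob_density p" "finite_entropy p"
  shows "diff_entropy (joint r p) = diff_entropy r + diff_entropy p"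
proof -
  have eq: "joint r p x * ln (joint r p x)
      = (r (fst x) * ln (r (fst x))) * p (snd x) + r (fst x) * (p (snd x) * ln (p (snd x)))" for x
  \<comment> \<open>The logarithm splits only for positive factors; where one of the densities
    vanishes, both sides are 0.\<close>
  proof (cases "r (fst x) = 0 \<or> p (snd x) = 0")
    case False
    then have "r (fst x) > 0" "p (snd x) > 0"
      using r(1) p(1) by (auto simp: prob_density_def less_le)
    then show ?thesis
      by (simp add: joint_def ln_mult algebra_simps)
  qed (auto simp: joint_def)
  have r': "integrable lborel r" "integrable lborel (\<lambda>m. r m * ln (r m))" "integral\<^sup>L lborel r = 1"
    and p': "integrable lborel p" "integrable lborel (\<lambda>y. p y * ln (p y))" "integral\<^sup>L lborel p = 1"
    using r p by (auto simp: prob_density_def finite_entropy_def)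
  show ?thesis
    unfolding diff_entropy_def eq
    by (subst Bochner_Integration.integral_add)
      (simp_all add: integrable_lborel_prod_mult[where f = "\<lambda>m. r m * ln (r m)"]
        integrable_lborel_prod_mult[where g = "\<lambda>y. p y * ln (p y)"]
        integral_lborel_prod_mult[where f = "\<lambda>m. r m * ln (r m)"]
        integral_lborel_prod_mult[where g = "\<lambda>y. p y * ln (p y)"] r' p')
qed

section \<open>Gibbs' inequality and the observed marginal\<close>

lemma integral_lborel_pos:
  fixes f :: "'a::euclidean_space \<Rightarrow> real"
  assumes f: "integrable lborel f" and pos: "\<And>x. f x > 0"
  shows "integral\<^sup>L lborel f > 0"
proof (rule ccontr)
  assume "\<not> ?thesis"
  moreover have nonneg: "AE x in lborel. 0 \<le> f x"
    using pos by (simp add: less_imp_le)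
  ultimately have "integral\<^sup>L lborel f = 0"
    using integral_nonneg_AE[OF nonneg] by linarith
  then have "AE x in lborel. f x = 0"
    using integral_nonneg_eq_0_iff_AE[OF f nonneg] by simp
  then have "AE x in (lborel :: 'a measure). False"
    by eventually_elim (use pos in \<open>simp add: less_imp_neq[THEN not_sym]\<close>)
  then have "emeasure (lborel :: 'a measure) UNIV = 0"
    by (simp add: AE_iff_measurable[where N = UNIV])
  then show False
    by (simp add: emeasure_lborel_UNIV)
qed

text \<open>Pointwise Gibbs' inequality, from \<open>ln z \<le> z - 1\<close> at
  \<open>z = b / a\<close>. Upon integration against two probability densities the terms
  \<open>b - a\<close> cancel. The convention \<open>ln 0 = 0\<close> covers
  \<open>a = 0\<close>.\<close>

lemma mult_ln_le:
  fixes a b :: real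
  assumes "0 \<le> a" "0 < b"
  shows "a * ln b \<le> a * ln a + b - a"
proof (cases "a = 0")
  case False
  then have "a > 0"
    using assms by simp
  then have "a * ln (b / a) \<le> a * (b / a - 1)"
    using assms by (intro mult_left_mono ln_le_minus_one) auto
  then show ?thesis
    using \<open>a > 0\<close> assms by (simp add: ln_div algebra_simps)
qed (use assms in simp)

text \<open>Fubini yields integrable slices only almost everywhere, and a slice that is not
  integrable has integral 0 by convention; hence positivity of the marginal is claimed almost
  everywhere.\<close>

lemma
  fixes phat :: "'m::euclidean_space \<times> 'o::euclidean_space \<Rightarrow> real"
  assumes phat: "prob_density phat" "\<And>x. phat x > 0"
  shows integrable_marginal_obs: "integrable lborel (marginal_obs phat)"
    and integral_marginal_obs: "integral\<^sup>L lborel (marginal_obs phat) = 1"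
    and AE_integrable_section: "AE y in lborel. integrable lborel (\<lambda>m. phat (m, y))"
    and AE_marginal_obs_pos: "AE y in lborel. marginal_obs phat y > 0"
proof -
  have int: "integrable (lborel \<Otimes>\<^sub>M lborel) (case_prod (\<lambda>m y. phat (m, y)))"
    and one: "integral\<^sup>L (lborel \<Otimes>\<^sub>M lborel) (case_prod (\<lambda>m y. phat (m, y))) = 1"
    using phat(1) by (simp_all add: prob_density_def lborel_prod)
  show "integrable lborel (marginal_obs phat)"
    using lborel_pair.integrable_snd[OF int] by (simp add: marginal_obs_def[abs_def])
  show "integral\<^sup>L lborel (marginal_obs phat) = 1"
    using lborel_pair.integral_snd[OF int] one by (simp add: marginal_obs_def[abs_def])
  show AE: "AE y in lborel. integrable lborel (\<lambda>m. phat (m, y))"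
    by (rule lborel_pair.AE_integrable_snd[OF int])
  then show "AE y in lborel. marginal_obs phat y > 0"
    by eventually_elim (simp add: marginal_obs_def integral_lborel_pos phat(2))
qed

lemma cross_entropy_marginal_ge:
  fixes phat :: "'m::euclidean_space \<times> 'o::euclidean_space \<Rightarrow> real"
  assumes phat: "prob_density phat" "\<And>x. phat x > 0"
    and p: "prob_density p" "finite_entropy p"
    and int: "integrable lborel (\<lambda>y. p y * ln (marginal_obs phat y))"
  shows "(LINT y|lborel. p y * ln (marginal_obs phat y)) \<le> - diff_entropy p"
proof -
  have p': "integrable lborel p" "integrable lborel (\<lambda>y. p y * ln (p y))" "integral\<^sup>L lborel p = 1"
    "\<And>y. 0 \<le> p y"
    using p by (auto simp: prob_density_def finite_entropy_def)
  note marg = integrable_marginal_obs[OF phat] integral_marginal_obs[OF phat]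
  have "(LINT y|lborel. p y * ln (marginal_obs phat y))
      \<le> (LINT y|lborel. p y * ln (p y) + marginal_obs phat y - p y)"
  proof (rule integral_mono_AE[OF int])
    show "AE y in lborel. p y * ln (marginal_obs phat y) \<le> p y * ln (p y) + marginal_obs phat y - p y"
      using AE_marginal_obs_pos[OF phat] by eventually_elim (rule mult_ln_le[OF p'(4)])
  qed (intro Bochner_Integration.integrable_diff Bochner_Integration.integrable_add p' marg)
  also have "\<dots> = - diff_entropy p"
    using p' marg by (simp add: diff_entropy_def)
  finally show ?thesis .
qed

text \<open>Splitting the joint log-likelihood requires
  \<open>p y * ln (marginal_obs phat y)\<close> to be integrable. Gibbs' inequality for
  \<open>p\<close> bounds it above; Gibbs' inequality for \<open>r\<close> against the conditional
  density bounds it below by \<open>p y * (a y - K)\<close>, and both bounds are integrable.\<close>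

lemma F_joint_NER_eq_F_NER:
  fixes phat :: "'m::euclidean_space \<times> 'o::euclidean_space \<Rightarrow> real"
  assumes phat: "prob_density phat" "\<And>x. phat x > 0"
    and p: "prob_density p" "finite_entropy p"
    and r: "prob_density r" "finite_entropy r"
    and int: "integrable (law (joint r p)) (\<lambda>x. ln (phat x))"
  shows "F_joint_NER phat lam (joint r p)
      = F_NER phat p lam r - (lam * diff_entropy p - (LINT y|lborel. p y * ln (marginal_obs phat y)))"
proof -
  note [measurable] = prob_density_measurable[OF phat(1)] prob_density_measurable[OF p(1)]
    prob_density_measurable[OF r(1)]
  have r': "integrable lborel r" "integrable lborel (\<lambda>m. r m * ln (r m))" "integral\<^sup>L lborel r = 1"
    "\<And>m. 0 \<le> r m"
    and p': "integrable lborel p" "integrable lborel (\<lambda>y. p y * ln (p y))" "integral\<^sup>L lborel p = 1"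
    "\<And>y. 0 \<le> p y"
    using r p by (auto simp: prob_density_def finite_entropy_def)
  note rp = prob_density_joint[OF r(1) p(1)]
  have [measurable]: "marginal_obs phat \<in> borel_measurable borel"
    using integrable_marginal_obs[OF phat] by (auto dest: borel_measurable_integrable)
  define a where "a y = (LINT m|lborel. r m * ln (phat (m, y)))" for y
  define K where "K = (LINT m|lborel. r m * ln (r m))"
  have "integrable lborel (\<lambda>x. joint r p x * ln (phat x))"
    using int prob_density_measurable[OF rp] rp
    by (subst (asm) integrable_density) (auto simp: prob_density_def)
  then have int': "integrable (lborel \<Otimes>\<^sub>M lborel) (case_prod (\<lambda>m y. p y * (r m * ln (phat (m, y)))))"
    unfolding lborel_prod by (simp add: joint_def case_prod_beta' mult_ac)
  have int_pa: "integrable lborel (\<lambda>y. p y * a y)"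
    using lborel_pair.integrable_snd[OF int'] by (simp add: a_def)
  have E: "(LINT x|lborel. joint r p x * ln (phat x)) = (LINT y|lborel. p y * a y)"
    using lborel_pair.integral_snd[OF int'] unfolding lborel_prod
    by (simp add: a_def joint_def case_prod_beta' mult_ac)
  \<comment> \<open>Fubini sees the slices only after multiplication by \<open>p y\<close>; where
    that factor vanishes the slice may fail to be integrable, but its contribution is 0.\<close>
  have AE_int: "AE y in lborel. p y \<noteq> 0 \<longrightarrow> integrable lborel (\<lambda>m. r m * ln (phat (m, y)))"
    using lborel_pair.AE_integrable_snd[OF int'] by eventually_elim auto
  have lower: "AE y in lborel. p y * (a y - K) \<le> p y * ln (marginal_obs phat y)"
    using AE_int AE_marginal_obs_pos[OF phat] AE_integrable_section[OF phat]
  proof eventually_elim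
    fix y
    let ?g = "marginal_obs phat y"
    assume i: "p y \<noteq> 0 \<longrightarrow> integrable lborel (\<lambda>m. r m * ln (phat (m, y)))"
      and g: "?g > 0" and s: "integrable lborel (\<lambda>m. phat (m, y))"
    show "p y * (a y - K) \<le> p y * ln ?g"
    proof (cases "p y = 0")
      case False
      \<comment> \<open>\<open>mult_ln_le\<close> with \<open>b\<close> the conditional density at
        \<open>y\<close>. Both \<open>phat (m, y) / ?g\<close> and \<open>r\<close> have mass 1, so
        the right-hand side integrates to \<open>K + ln ?g\<close>.\<close>
      have "a y \<le> (LINT m|lborel. r m * ln (r m) + r m * ln ?g + phat (m, y) / ?g - r m)"
        unfolding a_def
      proof (rule integral_mono)
        show "r m * ln (phat (m, y)) \<le> r m * ln (r m) + r m * ln ?g + phat (m, y) / ?g - r m" for m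
          using mult_ln_le[OF r'(4), of "phat (m, y) / ?g" m] phat(2)[of "(m, y)"] g
          by (simp add: ln_div algebra_simps)
      qed (use i False s r' in auto)
      also have "\<dots> = K + ln ?g + (LINT m|lborel. phat (m, y)) / ?g - 1"
        using r' s by (simp add: K_def)
      also have "(LINT m|lborel. phat (m, y)) / ?g = 1"
        using g by (simp add: marginal_obs_def)
      finally show ?thesis
        using p'(4)[of y] by (intro mult_left_mono) auto
    qed simp
  qed
  have upper: "AE y in lborel. p y * ln (marginal_obs phat y) \<le> p y * ln (p y) + marginal_obs phat y - p y"
    using AE_marginal_obs_pos[OF phat] by eventually_elim (rule mult_ln_le[OF p'(4)])
  have int_marg: "integrable lborel (\<lambda>y. p y * ln (marginal_obs phat y))"
  proof (rule Bochner_Integration.integrable_bound)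
    show "integrable lborel (\<lambda>y. \<bar>p y * a y - p y * K\<bar> + \<bar>p y * ln (p y) + marginal_obs phat y - p y\<bar>)"
      by (intro Bochner_Integration.integrable_add Bochner_Integration.integrable_diff integrable_abs
          integrable_mult_left int_pa p' integrable_marginal_obs phat)
    show "AE y in lborel. norm (p y * ln (marginal_obs phat y))
        \<le> norm (\<bar>p y * a y - p y * K\<bar> + \<bar>p y * ln (p y) + marginal_obs phat y - p y\<bar>)"
      using lower upper by eventually_elim (auto simp: right_diff_distrib)
  qed measurable
  have "expect p (\<lambda>y. expect r (\<lambda>m. ln (conditional_miss phat m y)))
      = (LINT y|lborel. p y * (LINT m|lborel. r m * ln (phat (m, y) / marginal_obs phat y)))"
    unfolding conditional_miss_def
    by (simp add: expect_eq_lborel[OF r(1)] expect_eq_lborel[OF p(1)])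
  also have "\<dots> = (LINT y|lborel. p y * a y - p y * ln (marginal_obs phat y))"
  proof (rule integral_cong_AE)
    show "AE y in lborel. p y * (LINT m|lborel. r m * ln (phat (m, y) / marginal_obs phat y))
        = p y * a y - p y * ln (marginal_obs phat y)"
      using AE_int AE_marginal_obs_pos[OF phat]
    proof eventually_elim
      fix y
      let ?g = "marginal_obs phat y"
      assume i: "p y \<noteq> 0 \<longrightarrow> integrable lborel (\<lambda>m. r m * ln (phat (m, y)))" and g: "?g > 0"
      show "p y * (LINT m|lborel. r m * ln (phat (m, y) / ?g)) = p y * a y - p y * ln ?g"
      proof (cases "p y = 0")
        case False
        have "(LINT m|lborel. r m * ln (phat (m, y) / ?g))
            = (LINT m|lborel. r m * ln (phat (m, y)) - r m * ln ?g)"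
          using g phat(2) by (simp add: ln_div right_diff_distrib less_imp_neq[THEN not_sym])
        also have "\<dots> = a y - ln ?g"
          using i False r' by (simp add: a_def)
        finally show ?thesis
          by (simp add: right_diff_distrib)
      qed simp
    qed
  qed (unfold a_def, measurable)
  also have "\<dots> = (LINT y|lborel. p y * a y) - (LINT y|lborel. p y * ln (marginal_obs phat y))"
    by (rule Bochner_Integration.integral_diff[OF int_pa int_marg])
  finally have cond: "expect p (\<lambda>y. expect r (\<lambda>m. ln (conditional_miss phat m y)))
      = (LINT y|lborel. p y * a y) - (LINT y|lborel. p y * ln (marginal_obs phat y))" .
  have "expect (joint r p) (\<lambda>x. ln (phat x)) = (LINT y|lborel. p y * a y)"
    by (simp add: expect_eq_lborel[OF rp] E)
  then show "F_joint_NER phat lam (joint r p)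
      = F_NER phat p lam r - (lam * diff_entropy p - (LINT y|lborel. p y * ln (marginal_obs phat y)))"
    unfolding F_joint_NER_def F_NER_def cond diff_entropy_joint[OF r p] by (simp add: algebra_simps)
qed

theorem proposition3p4:
  fixes phat :: "'m::euclidean_space \<times> 'o::euclidean_space \<Rightarrow> real"
    and p :: "'o \<Rightarrow> real"
    and lam h :: real
    and H :: "('m \<times> 'o \<Rightarrow> real) set"
    and ip :: "('m \<times> 'o \<Rightarrow> real) \<Rightarrow> ('m \<times> 'o \<Rightarrow> real) \<Rightarrow> real"
  assumes "lam > 0" and "h > 0"
    and "prob_density phat" and "\<And>x. phat x > 0" and "differentiable_miss phat"
    and "prob_density p" and "finite_entropy p" and "diff_entropy p \<ge> 0"
    and "rkhs (rbf h) H ip"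
  shows
    "(\<forall>(r :: real \<Rightarrow> 'm \<Rightarrow> real) \<tau>.
        prob_density (r \<tau>) \<and>
        integrable (law (joint (r \<tau>) p)) (grad_miss (\<lambda>x. ln (phat x))) \<longrightarrow>
        leads_to H ip phat (F_joint_NER phat lam)
          (joint_NER_rate phat lam (joint (r \<tau>) p)) (joint (r \<tau>) p) \<tau>
          (joint_NER_velocity phat lam h (joint (r \<tau>) p))) \<and>
     (\<exists>c\<ge>0. \<forall>r :: 'm \<Rightarrow> real.
        prob_density r \<and> finite_entropy r \<and>
        integrable (law (joint r p)) (\<lambda>x. ln (phat x)) \<longrightarrow>
        F_joint_NER phat lam (joint r p) \<le> F_NER phat p lam r \<and>
        F_joint_NER phat lam (joint r p) = F_NER phat p lam r - c)"
proof -
  interpret rkhs "rbf h" H ip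
    by fact
  interpret gaussian_rkhs_pair h H ip
    by unfold_locales fact
  note phat = assms(3,4,5)
  have "leads_to H ip phat (F_joint_NER phat lam) (joint_NER_rate phat lam (joint (r \<tau>) p))
      (joint (r \<tau>) p) \<tau> (joint_NER_velocity phat lam h (joint (r \<tau>) p))"
    if "prob_density (r \<tau>)" and score: "integrable (law (joint (r \<tau>) p)) (grad_miss (\<lambda>x. ln (phat x)))"
    for r :: "real \<Rightarrow> 'm \<Rightarrow> real" and \<tau>
  proof -
    note q = prob_density_joint[OF that(1) \<open>prob_density p\<close>]
    show ?thesis
      unfolding leads_to_def
      by (intro conjI allI impI ballI has_rate_joint_NER[OF phat] joint_NER_steepest_ascent[OF q score])
  qed
  moreover
  define c where "c = lam * diff_entropy p - (LINT y|lborel. p y * ln (marginal_obs phat y))"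
  text \<open>If the integral in \<open>c\<close> diverges, its value is 0 by convention.\<close>
  have "(LINT y|lborel. p y * ln (marginal_obs phat y)) \<le> 0"
  proof (cases "integrable lborel (\<lambda>y. p y * ln (marginal_obs phat y))")
    case True
    from cross_entropy_marginal_ge[OF phat(1,2) assms(6,7) True] show ?thesis
      using assms(8) by linarith
  qed (simp add: not_integrable_integral_eq)
  then have "c \<ge> 0"
    using mult_nonneg_nonneg[of lam "diff_entropy p"] assms(1,8) unfolding c_def by linarith
  moreover have "F_joint_NER phat lam (joint r p) = F_NER phat p lam r - c"
    if "prob_density r" "finite_entropy r" "integrable (law (joint r p)) (\<lambda>x. ln (phat x))"
    for r :: "'m \<Rightarrow> real"
    unfolding c_def by (rule F_joint_NER_eq_F_NER[OF phat(1,2) assms(6,7) that])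
  ultimately show ?thesis
    by (intro conjI allI impI exI[of _ c]) auto
qed

end
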